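(* Let $p$ be a prime, and let $H$ and $K$ be normally monomial finite $p$-groups whose centers are cyclic. Let $\psi$ be a faithful complex character of $H\times K$ of least degree among all faithful complex characters of $H\times K$. Then $\psi$ decomposes as $\psi=\chi+\eta$ for some irreducible complex characters $\chi,\eta$ of $H\times K$ with $\chi(1)=\max \mathrm{cd}(H)$ and $\eta(1)=\max \mathrm{cd}(K)$.
   Context: All groups are finite and all representations and characters are over $\mathbb{C}$. A character $\chi$ of $G$ is faithful if $\ker(\chi)=\{g\in G:\chi(g)=\chi(1)\}$ is trivial; characters need not be irreducible. $\mathrm{cd}(G)$ denotes the set of degrees of irreducible characters of $G$. A group $G$ is normally monomial if every irreducible character of $G$ is induced from a linear (degree $1$) character of some normal subgroup of $G$.
   Formalization: H and K are additionally assumed nontrivial; if one of them is trivial the claim fails, since a faithful character of least degree then has degree less than max cd(H) + max cd(K). *)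

theory Defs
  imports
    Complex_Main
    "HOL-Algebra.Elementary_Groups"
    "HOL-Computational_Algebra.Primes"
    "Jordan_Normal_Form.VS_Connect"
begin

section \<open>Groups\<close>

definition finite_p_group :: "nat \<Rightarrow> ('a, 'm) monoid_scheme \<Rightarrow> bool" where
  "finite_p_group p G \<longleftrightarrow> group G \<and> finite (carrier G) \<and> (\<exists>n. card (carrier G) = p ^ n)"

definition group_center :: "('a, 'm) monoid_scheme \<Rightarrow> 'a set" where
  "group_center G =
     {z \<in> carrier G. \<forall>g \<in> carrier G. z \<otimes>\<^bsub>G\<^esub> g = g \<otimes>\<^bsub>G\<^esub> z}"

section \<open>Complex representations and characters\<close>

definition GL :: "nat \<Rightarrow> complex mat monoid" where
  "GL n = units_of (ring_mat TYPE(complex) n ())"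

text \<open>Representations have positive degree, so the zero function is not a character.\<close>

definition group_rep :: "('a, 'm) monoid_scheme \<Rightarrow> nat \<Rightarrow> ('a \<Rightarrow> complex mat) \<Rightarrow> bool" where
  "group_rep G n \<rho> \<longleftrightarrow> n > 0 \<and> \<rho> \<in> hom G (GL n)"

definition irreducible_rep :: "('a, 'm) monoid_scheme \<Rightarrow> nat \<Rightarrow> ('a \<Rightarrow> complex mat) \<Rightarrow> bool" where
  "irreducible_rep G n \<rho> \<longleftrightarrow>
     group_rep G n \<rho> \<and>
     (\<forall>W. VectorSpace.subspace class_ring W (module_vec TYPE(complex) n) \<longrightarrow>
          (\<forall>g \<in> carrier G. \<forall>v \<in> W. \<rho> g *\<^sub>v v \<in> W) \<longrightarrow>
          W = {0\<^sub>v n} \<or> W = carrier_vec n)"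

text \<open>
  Characters are total functions whose values outside the carrier are irrelevant; accordingly,
  equalities of characters are always stated on the carrier.
\<close>

definition affords :: "('a, 'm) monoid_scheme \<Rightarrow> ('a \<Rightarrow> complex mat) \<Rightarrow> ('a \<Rightarrow> complex) \<Rightarrow> bool" where
  "affords G \<rho> \<chi> \<longleftrightarrow> (\<forall>g \<in> carrier G. \<chi> g = sum_list (diag_mat (\<rho> g)))"

definition is_character :: "('a, 'm) monoid_scheme \<Rightarrow> ('a \<Rightarrow> complex) \<Rightarrow> bool" where
  "is_character G \<chi> \<longleftrightarrow> (\<exists>n \<rho>. group_rep G n \<rho> \<and> affords G \<rho> \<chi>)"

definition irreducible_character :: "('a, 'm) monoid_scheme \<Rightarrow> ('a \<Rightarrow> complex) \<Rightarrow> bool" where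
  "irreducible_character G \<chi> \<longleftrightarrow> (\<exists>n \<rho>. irreducible_rep G n \<rho> \<and> affords G \<rho> \<chi>)"

text \<open>The value at the identity is the dimension of the representation, hence a natural number.\<close>

definition char_degree :: "('a, 'm) monoid_scheme \<Rightarrow> ('a \<Rightarrow> complex) \<Rightarrow> nat" where
  "char_degree G \<chi> = (THE n. \<chi> \<one>\<^bsub>G\<^esub> = of_nat n)"

lemma char_degree_eq:
  assumes "group G" "group_rep G n \<rho>" "affords G \<rho> \<chi>"
  shows "char_degree G \<chi> = n"
proof -
  interpret R: ring "ring_mat TYPE(complex) n ()"
    by (rule ring_mat)
  have "\<rho> \<one>\<^bsub>G\<^esub> = 1\<^sub>m n"
    using hom_one[of \<rho> G "GL n"] assms(1,2) R.units_group
    by (simp add: GL_def group_rep_def units_of_one ring_mat_simps)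
  then have "\<chi> \<one>\<^bsub>G\<^esub> = of_nat n"
    using assms(1,3) group.is_monoid monoid.one_closed
    by (fastforce simp: affords_def diag_mat_def interv_sum_list_conv_sum_set_nat)
  then show ?thesis
    unfolding char_degree_def by simp
qed

definition char_kernel :: "('a, 'm) monoid_scheme \<Rightarrow> ('a \<Rightarrow> complex) \<Rightarrow> 'a set" where
  "char_kernel G \<chi> = {g \<in> carrier G. \<chi> g = \<chi> \<one>\<^bsub>G\<^esub>}"

definition faithful_character :: "('a, 'm) monoid_scheme \<Rightarrow> ('a \<Rightarrow> complex) \<Rightarrow> bool" where
  "faithful_character G \<chi> \<longleftrightarrow> is_character G \<chi> \<and> char_kernel G \<chi> = {\<one>\<^bsub>G\<^esub>}"

definition cd :: "('a, 'm) monoid_scheme \<Rightarrow> nat set" where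
  "cd G = char_degree G ` {\<chi>. irreducible_character G \<chi>}"

section \<open>Normally monomial groups\<close>

definition induced_char ::
  "('a, 'm) monoid_scheme \<Rightarrow> 'a set \<Rightarrow> ('a \<Rightarrow> complex) \<Rightarrow> 'a \<Rightarrow> complex" where
  "induced_char G N \<phi> g =
     (\<Sum>x \<in> carrier G.
        let y = x \<otimes>\<^bsub>G\<^esub> g \<otimes>\<^bsub>G\<^esub> inv\<^bsub>G\<^esub> x in if y \<in> N then \<phi> y else 0)
       / of_nat (card N)"

definition linear_character :: "('a, 'm) monoid_scheme \<Rightarrow> ('a \<Rightarrow> complex) \<Rightarrow> bool" where
  "linear_character G \<phi> \<longleftrightarrow> is_character G \<phi> \<and> char_degree G \<phi> = 1"

definition normally_monomial :: "('a, 'm) monoid_scheme \<Rightarrow> bool" where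
  "normally_monomial G \<longleftrightarrow>
     (\<forall>\<chi>. irreducible_character G \<chi> \<longrightarrow>
        (\<exists>N \<phi>. N \<lhd> G \<and> linear_character (G\<lparr>carrier := N\<rparr>) \<phi> \<and>
               (\<forall>g \<in> carrier G. \<chi> g = induced_char G N \<phi> g)))"

end

theory Submission
  imports
    Defs
    "Jordan_Normal_Form.DL_Rank"
    "Jordan_Normal_Form.Spectral_Radius"
    "HOL-Algebra.Group_Action"
    "HOL-Algebra.Multiplicative_Group"
begin

text \<open>
  Let \<open>z\<close> and \<open>w\<close> generate the unique subgroups of order \<open>p\<close> of the cyclic centers of \<open>H\<close> and \<open>K\<close>.
  A nontrivial normal subgroup of \<open>H\<close> meets the center, hence contains \<open>z\<close>; so an irreducible
  representation of \<open>H\<close> is faithful as soon as \<open>z\<close> acts nontrivially. If a faithful irreducible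
  character is induced from a linear character of a normal subgroup \<open>N\<close>, then \<open>N\<close> is abelian, so its
  degree, the index of \<open>N\<close>, bounds all irreducible degrees and equals \<open>max cd(H)\<close>.

  Decompose \<open>\<psi>\<close> into irreducible constituents; on each of them \<open>z\<close> and \<open>w\<close> act by \<open>p\<close>-th roots of unity.
  There are two different constituents on which \<open>z\<close>, respectively \<open>w\<close>, acts nontrivially:
  if only one constituent were available for both, some \<open>z\<^sup>k w\<close> would lie in the kernel of \<open>\<psi>\<close>.
  Restricting to the factors, these two have degree at least \<open>max cd(H)\<close> and \<open>max cd(K)\<close>. But
  inflating faithful irreducible characters of \<open>H\<close> and \<open>K\<close> and adding them gives a faithful character
  of degree \<open>max cd(H) + max cd(K)\<close>, so by minimality there are no other constituents and the
  degrees are exact.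
\<close>

section \<open>Traces, adapted bases and matrices of finite order\<close>

abbreviation trace_mat :: "complex mat \<Rightarrow> complex" where
  "trace_mat A \<equiv> sum_list (diag_mat A)"

lemma trace_mat_sum:
  assumes "A \<in> carrier_mat n n"
  shows "trace_mat A = (\<Sum>i<n. A $$ (i, i))"
  using assms by (simp add: diag_mat_def interv_sum_list_conv_sum_set_nat atLeast0LessThan)

lemma trace_mat_comm:
  assumes A: "A \<in> carrier_mat n m" and B: "B \<in> carrier_mat m n"
  shows "trace_mat (A * B) = trace_mat (B * A)"
proof -
  have "trace_mat (A * B) = (\<Sum>i<n. \<Sum>j<m. A $$ (i, j) * B $$ (j, i))"
    using A B by (subst trace_mat_sum[of _ n]) (auto simp: scalar_prod_def atLeast0LessThan)
  also have "\<dots> = (\<Sum>j<m. \<Sum>i<n. B $$ (j, i) * A $$ (i, j))"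
    by (subst sum.swap) (simp add: mult.commute)
  also have "\<dots> = trace_mat (B * A)"
    using A B by (subst trace_mat_sum[of _ m]) (auto simp: scalar_prod_def atLeast0LessThan)
  finally show ?thesis .
qed

lemma trace_mat_conj:
  assumes "A \<in> carrier_mat n n" "P \<in> carrier_mat n n" "Q \<in> carrier_mat n n" "P * Q = 1\<^sub>m n"
  shows "trace_mat (Q * A * P) = trace_mat A"
proof -
  have "trace_mat (Q * A * P) = trace_mat (P * (Q * A))"
    using assms by (intro trace_mat_comm) auto
  also have "P * (Q * A) = A"
    using assms by (metis assoc_mult_mat left_mult_one_mat)
  finally show ?thesis .
qed

lemma trace_mat_four_block:
  assumes "A \<in> carrier_mat n n" "D \<in> carrier_mat m m"
  shows "trace_mat (four_block_mat A B C D) = trace_mat A + trace_mat D"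
  using diag_four_block_mat[OF assms] by simp

section \<open>Bases adapted to a subspace of the coordinate space\<close>

context vec_space
begin

text \<open>Independent sets have at most \<open>n\<close> elements, so \<open>W\<close> contains a
  maximal one; by maximality, adjoining any further vector of \<open>W\<close> creates a dependence,
  so the vector already lies in the span.\<close>

lemma exists_subspace_basis:
  assumes W: "VectorSpace.subspace class_ring W V"
  obtains \<beta> where "finite \<beta>" "\<beta> \<subseteq> W" "lin_indpt \<beta>" "span \<beta> = W"
proof -
  have subm: "submodule class_ring W V"
    using W by (simp add: VectorSpace.subspace_def)
  have Wc: "W \<subseteq> carrier_vec n"
    using subm by (auto simp: submodule_def module_vec_simps)
  let ?P = "\<lambda>S. S \<subseteq> W \<and> lin_indpt S"
  have "lin_indpt {}"
    by (simp add: lin_dep_def)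
  then obtain \<beta> where \<beta>: "finite \<beta>" "maximal \<beta> ?P"
    using maximal_exists[of ?P n "{}"] li_le_dim[OF fin_dim] Wc dim_is_n by fastforce
  then have \<beta>W: "\<beta> \<subseteq> W" and li: "lin_indpt \<beta>"
    by (auto simp: maximal_def)
  have "v \<in> span \<beta>" if v: "v \<in> W" for v
  proof (cases "v \<in> \<beta>")
    case True
    then show ?thesis using \<beta>W Wc by (meson span_mem subset_trans)
  next
    case False
    have "lin_dep (\<beta> \<union> {v})"
    proof (rule ccontr)
      assume "\<not> ?thesis"
      then have "?P (\<beta> \<union> {v})" using \<beta>W v by auto
      then have "\<beta> \<union> {v} = \<beta>" using \<beta>(2) unfolding maximal_def by blast
      then show False using False by auto
    qed
    then show ?thesis
      using lin_dep_iff_in_span[of \<beta> v] \<beta>W Wc li v False by auto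
  qed
  moreover have "span \<beta> \<subseteq> W"
    using span_is_subset[OF \<beta>W subm] .
  ultimately show ?thesis
    using that[OF \<beta>(1) \<beta>W li] by blast
qed

text \<open>A basis of \<open>W\<close> is extended to a basis of the whole space and listed first.
  The columns of \<open>P\<close> are this basis, so \<open>Q\<close>, its inverse, computes
  coordinates, and vectors of \<open>W\<close> have no coordinates from position \<open>d\<close>
  on.\<close>

lemma exists_adapted_basis:
  assumes W: "VectorSpace.subspace class_ring W V" and nz: "W \<noteq> {0\<^sub>v n}" and nf: "W \<noteq> carrier_vec n"
  obtains d P Q where "0 < d" "d < n" "P \<in> carrier_mat n n" "Q \<in> carrier_mat n n"
    "P * Q = 1\<^sub>m n" "Q * P = 1\<^sub>m n"
    "\<And>j. j < d \<Longrightarrow> col P j \<in> W"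
    "\<And>v i. v \<in> W \<Longrightarrow> d \<le> i \<Longrightarrow> i < n \<Longrightarrow> (Q *\<^sub>v v) $ i = 0"
proof -
  obtain \<beta> where \<beta>: "finite \<beta>" "\<beta> \<subseteq> W" "lin_indpt \<beta>" "span \<beta> = W"
    using exists_subspace_basis[OF W] .
  have Wc: "W \<subseteq> carrier_vec n"
    using W by (auto simp: VectorSpace.subspace_def submodule_def module_vec_simps)
  have \<beta>c: "\<beta> \<subseteq> carrier_vec n" using \<beta> Wc by auto
  let ?P = "\<lambda>S. S \<subseteq> carrier_vec n \<and> \<beta> \<subseteq> S \<and> lin_indpt S"
  obtain \<gamma> where \<gamma>: "finite \<gamma>" "maximal \<gamma> ?P"
    using maximal_exists[of ?P n \<beta>] li_le_dim[OF fin_dim] dim_is_n \<beta>(3) \<beta>c by fastforce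
  \<comment> \<open>An independent set containing \<open>\<gamma>\<close> also contains
    \<open>\<beta>\<close>, so maximality among extensions of \<open>\<beta>\<close> is maximality
    outright.\<close>
  have "maximal \<gamma> (\<lambda>S. S \<subseteq> carrier_vec n \<and> lin_indpt S)"
    using \<gamma>(2) unfolding maximal_def by blast
  then have bas: "basis \<gamma>"
    using max_li_is_basis by simp
  have \<gamma>c: "\<gamma> \<subseteq> carrier_vec n" and \<beta>\<gamma>: "\<beta> \<subseteq> \<gamma>" and li: "lin_indpt \<gamma>"
    using \<gamma>(2) by (auto simp: maximal_def)
  have card\<gamma>: "card \<gamma> = n"
    using dim_basis[OF \<gamma>(1) bas] dim_is_n by simp
  obtain bs where bs: "set bs = \<beta>" "distinct bs"
    using finite_distinct_list[OF \<beta>(1)] by auto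
  obtain cs where cs: "set cs = \<gamma> - \<beta>" "distinct cs"
    using finite_distinct_list[of "\<gamma> - \<beta>"] \<gamma>(1) by auto
  define xs where "xs = bs @ cs"
  define d where "d = length bs"
  have xs: "distinct xs" "set xs = \<gamma>"
    using bs cs \<beta>\<gamma> by (auto simp: xs_def)
  moreover from this have "length xs = n"
    using card\<gamma> distinct_card by metis
  ultimately have xs: "distinct xs" "set xs = \<gamma>" "length xs = n" by auto
  define P where "P = mat_of_cols n xs"
  have P: "P \<in> carrier_mat n n" using xs by (auto simp: P_def)
  have colsP: "cols P = xs"
    using xs \<gamma>c by (simp add: P_def)
  have Pcol: "col P j = xs ! j" if "j < n" for j
    using that P colsP by (metis carrier_matD(2) cols_nth)
  have "rank P = n"
    using lin_indpt_full_rank[OF P] colsP xs li by simp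
  then have "det P \<noteq> 0"
    using det_rank_iff[OF P] by simp
  then obtain Q where Q: "Q \<in> carrier_mat n n" "Q * P = 1\<^sub>m n" "P * Q = 1\<^sub>m n"
    using det_non_zero_imp_unit[OF P, of "()"] by (auto simp: Units_def ring_mat_simps)
  have dn: "d \<le> n"
    using xs by (simp add: xs_def d_def)
  have "d \<noteq> 0"
  proof
    assume "d = 0"
    then have "\<beta> = {}" using bs by (simp add: d_def)
    then show False using \<beta>(4) nz span_empty by simp
  qed
  moreover have "d \<noteq> n"
  proof
    assume "d = n"
    then have "cs = []" using xs by (simp add: xs_def d_def)
    then have "\<gamma> = \<beta>" using cs \<beta>\<gamma> by auto
    then show False using bas \<beta>(4) nf by (simp add: basis_def)
  qed
  moreover have "col P j \<in> W" if "j < d" for j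
  proof -
    have "col P j = xs ! j"
      using that dn Pcol by simp
    then show ?thesis using that bs \<beta>(2) by (auto simp: xs_def d_def nth_append)
  qed
  moreover have "(Q *\<^sub>v v) $ i = 0" if v: "v \<in> W" and i: "d \<le> i" "i < n" for v i
  proof -
    obtain f where f: "v = lincomb f \<beta>"
      using v \<beta>(4) finite_span[OF \<beta>(1) \<beta>c] by auto
    \<comment> \<open>Coefficients extended by zero off \<open>\<beta>\<close> express
      \<open>v\<close> in the columns of \<open>P\<close>; then \<open>Q\<close> returns exactly
      these coefficients.\<close>
    let ?f = "\<lambda>x. if x \<in> \<beta> then f x else 0"
    have "lincomb ?f \<gamma> = lincomb f \<beta>"
    proof (rule eq_vecI)
      show "dim_vec (lincomb ?f \<gamma>) = dim_vec (lincomb f \<beta>)"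
        using lincomb_dim[OF \<gamma>(1) \<gamma>c] lincomb_dim[OF \<beta>(1) \<beta>c] by simp
      fix k assume "k < dim_vec (lincomb f \<beta>)"
      then have k: "k < n" using lincomb_dim[OF \<beta>(1) \<beta>c] by simp
      show "lincomb ?f \<gamma> $ k = lincomb f \<beta> $ k"
        unfolding lincomb_index[OF k \<gamma>c] lincomb_index[OF k \<beta>c]
        using \<gamma>(1) \<beta>\<gamma> by (intro sum.mono_neutral_cong_right) auto
    qed
    then have "v = P *\<^sub>v vec n (\<lambda>i. ?f (col P i))"
      using mat_mult_eq_lincomb[OF P, of ?f] colsP xs f by simp
    then have "Q *\<^sub>v v = (Q * P) *\<^sub>v vec n (\<lambda>i. ?f (col P i))"
      using assoc_mult_mat_vec[OF Q(1) P vec_carrier] by simp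
    then have "Q *\<^sub>v v = vec n (\<lambda>i. ?f (col P i))"
      unfolding Q(2) by simp
    moreover have "col P i \<notin> \<beta>"
    proof -
      have "col P i = xs ! i"
        using i Pcol by simp
      also have "\<dots> = cs ! (i - d)" using i by (simp add: xs_def d_def nth_append)
      also have "\<dots> \<in> set cs" using i xs by (intro nth_mem) (auto simp: xs_def d_def)
      finally show ?thesis using cs by auto
    qed
    ultimately show ?thesis using i by simp
  qed
  ultimately show ?thesis
    using that[of d P Q] P Q dn by auto
qed

end

text \<open>
  Induction over the columns: if \<open>U e\<^sub>j = e\<^sub>j + w\<close> with \<open>w\<close> in the span of the previous unit vectors,
  which \<open>U\<close> fixes, then \<open>U\<^sup>k e\<^sub>j = e\<^sub>j + k w\<close>, whence \<open>w = 0\<close>.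
\<close>

lemma upper_triangular_finite_order:
  fixes U :: "complex mat"
  assumes U: "U \<in> carrier_mat n n" "upper_triangular U" "\<And>i. i < n \<Longrightarrow> U $$ (i, i) = 1"
    and k: "U ^\<^sub>m k = 1\<^sub>m n" "k > 0"
  shows "U = 1\<^sub>m n"
proof -
  have *: "U *\<^sub>v unit_vec n j = unit_vec n j" if "j < n" for j
    using that
  proof (induction j rule: less_induct)
    case (less j)
    \<comment> \<open>By induction the columns of \<open>U\<close> before \<open>j\<close> are unit
      vectors, so \<open>U\<close> fixes every vector supported on the coordinates before
      \<open>j\<close>.\<close>
    have fixed_below: "U *\<^sub>v w = w" if w: "w \<in> carrier_vec n" "\<And>i. j \<le> i \<Longrightarrow> i < n \<Longrightarrow> w $ i = 0" for w
    proof (rule eq_vecI)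
      show "dim_vec (U *\<^sub>v w) = dim_vec w" using U w by auto
      fix i assume "i < dim_vec w"
      then have i: "i < n" using w by simp
      have "(U *\<^sub>v w) $ i = (\<Sum>l<n. U $$ (i, l) * w $ l)"
        using U w i by (simp add: scalar_prod_def atLeast0LessThan)
      also have "\<dots> = (\<Sum>l<n. (if i = l then 1 else 0) * w $ l)"
      proof (rule sum.cong)
        fix l assume l: "l \<in> {..<n}"
        show "U $$ (i, l) * w $ l = (if i = l then 1 else 0) * w $ l"
        proof (cases "l < j")
          case True
          have "(U *\<^sub>v unit_vec n l) $ i = unit_vec n l $ i"
            using less.IH[of l] True l by simp
          then have "U $$ (i, l) = (if i = l then 1 else 0)"
            using U i l by (simp add: index_unit_vec)
          then show ?thesis by simp
        qed (use w l in auto)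
      qed auto
      also have "\<dots> = w $ i" using i by (simp add: if_distrib[of "\<lambda>x. x * _"] cong: if_cong)
      finally show "(U *\<^sub>v w) $ i = w $ i" .
    qed
    define w where "w = U *\<^sub>v unit_vec n j - unit_vec n j"
    have wc: "w \<in> carrier_vec n" using U by (auto simp: w_def)
    have "U *\<^sub>v w = w"
    proof (rule fixed_below[OF wc])
      fix i assume "j \<le> i" "i < n"
      then show "w $ i = 0"
        using U upper_triangularD[OF U(2), of j i] less.prems
        by (cases "i = j") (auto simp: w_def)
    qed
    have Uj: "U *\<^sub>v unit_vec n j = unit_vec n j + w"
      using U by (auto simp: w_def)
    have Upw: "U ^\<^sub>m m *\<^sub>v w = w" for m
    proof (induction m)
      case (Suc m)
      then show ?case
        using U wc \<open>U *\<^sub>v w = w\<close> by (simp add: assoc_mult_mat_vec[of _ n n _ n])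
    qed (use U wc in auto)
    have pow: "U ^\<^sub>m m *\<^sub>v unit_vec n j = unit_vec n j + of_nat m \<cdot>\<^sub>v w" for m
    proof (induction m)
      case 0
      then show ?case using U wc by auto
    next
      case (Suc m)
      have "U ^\<^sub>m Suc m *\<^sub>v unit_vec n j = U ^\<^sub>m m *\<^sub>v (U *\<^sub>v unit_vec n j)"
        using U by (simp add: assoc_mult_mat_vec[of _ n n _ n])
      also have "\<dots> = U ^\<^sub>m m *\<^sub>v unit_vec n j + w"
        unfolding Uj using U wc Upw[of m] by (simp add: mult_add_distrib_mat_vec[of _ n n])
      also have "\<dots> = unit_vec n j + of_nat (Suc m) \<cdot>\<^sub>v w"
        unfolding Suc using wc by (intro eq_vecI) (auto simp: algebra_simps)
      finally show ?case .
    qed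
    have "w $ i = 0" if "i < n" for i
    proof -
      have "unit_vec n j = unit_vec n j + of_nat k \<cdot>\<^sub>v w"
        using pow[of k] k by simp
      then have "unit_vec n j $ i = (unit_vec n j + of_nat k \<cdot>\<^sub>v w) $ i" by simp
      then show ?thesis using k wc that by simp
    qed
    then have "w = 0\<^sub>v n" using wc by auto
    then show ?case using Uj by simp
  qed
  show ?thesis
  proof (rule eq_matI)
    fix i j assume "i < dim_row (1\<^sub>m n :: complex mat)" "j < dim_col (1\<^sub>m n :: complex mat)"
    then have "(U *\<^sub>v unit_vec n j) $ i = unit_vec n j $ i" "i < n" "j < n"
      using * by auto
    then show "U $$ (i, j) = 1\<^sub>m n $$ (i, j)" using U by (auto simp: index_unit_vec)
  qed (use U in auto)
qed

text \<open>\<open>A\<close> is similar to an upper triangular \<open>B\<close> whose diagonal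
  entries are roots of unity, so each has real part at most 1. Equality of the sums forces all of
  them to be 1, and then finite order forces \<open>B\<close> to be the identity. This is the link
  between the kernel of a character, defined by a trace value, and the kernel of the
  representation.\<close>

lemma finite_order_trace:
  fixes A :: "complex mat"
  assumes A: "A \<in> carrier_mat n n" and k: "A ^\<^sub>m k = 1\<^sub>m n" "k > 0"
  shows "Re (trace_mat A) \<le> of_nat n" "Re (trace_mat A) = of_nat n \<Longrightarrow> A = 1\<^sub>m n"
proof -
  obtain es where es: "char_poly A = (\<Prod>e\<leftarrow>es. [:- e, 1:])"
    using char_poly_factorized[OF A] by auto
  obtain B where B: "B \<in> carrier_mat n n" "upper_triangular B" "similar_mat A B"
    using schur_decomposition_exists[OF A es] by auto
  obtain P Q where PQ: "similar_mat_wit A B P Q"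
    using B(3) unfolding similar_mat_def by blast
  note w = similar_mat_witD2[OF A PQ]
  have tr: "trace_mat A = (\<Sum>i<n. B $$ (i, i))"
    using trace_mat_conj[OF B(1) w(7) w(6)] w trace_mat_sum[OF B(1)] by simp
  have Bk: "B ^\<^sub>m k = 1\<^sub>m n"
  proof -
    have "similar_mat_wit (A ^\<^sub>m k) (B ^\<^sub>m k) P Q"
      by (rule similar_mat_wit_pow[OF PQ])
    then have "1\<^sub>m n = P * B ^\<^sub>m k * Q"
      using k A similar_mat_witD2(3) by (metis one_carrier_mat)
    then have "Q * 1\<^sub>m n * P = Q * (P * B ^\<^sub>m k * Q) * P" by simp
    also have "\<dots> = B ^\<^sub>m k"
    proof -
      have c: "P \<in> carrier_mat n n" "Q \<in> carrier_mat n n" "B ^\<^sub>m k \<in> carrier_mat n n"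
        using w by auto
      have "Q * (P * B ^\<^sub>m k * Q) * P = (Q * P) * (B ^\<^sub>m k * (Q * P))"
        using c by (simp only: assoc_mult_mat[of _ n n _ n _ n] mult_carrier_mat[of _ n n _ n])
      then show ?thesis using c(3) w(2) by (simp only: left_mult_one_mat right_mult_one_mat)
    qed
    finally show ?thesis using w(2,6,7) right_mult_one_mat[OF w(7)] by simp
  qed
  \<comment> \<open>Diagonal entries of a triangular matrix are eigenvalues, and
    \<open>B ^\<^sub>m k = 1\<^sub>m n\<close> fixes an eigenvector.\<close>
  have diag: "B $$ (i, i) ^ k = 1" if i: "i < n" for i
  proof -
    have "eigenvalue B (B $$ (i, i))"
      using eigenvalue_root_char_poly[OF B(1)] char_poly_upper_triangular[OF B(1,2)] i B(1)
      by (force simp: poly_prod_list prod_list_zero_iff diag_mat_def)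
    then obtain v where v: "eigenvector B v (B $$ (i, i))"
      by (auto simp: eigenvalue_def)
    then have v': "v \<in> carrier_vec n" "v \<noteq> 0\<^sub>v n"
      using B by (auto simp: eigenvector_def)
    have "v = (B $$ (i, i) ^ k) \<cdot>\<^sub>v v"
      using eigenvector_pow[OF B(1) v, of k] Bk v' by simp
    moreover obtain j where "j < n" "v $ j \<noteq> 0" using v' by (metis eq_vecI carrier_vecD index_zero_vec)
    ultimately show ?thesis using v'
      by (metis carrier_vecD index_smult_vec(1) mult_cancel_right2)
  qed
  have nrm: "norm (B $$ (i, i)) = 1" if "i < n" for i
    using diag[OF that] k(2) by (metis norm_one norm_power norm_ge_zero power_eq_1_iff abs_norm_cancel less_irrefl)
  then have le: "Re (B $$ (i, i)) \<le> 1" if "i < n" for i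
    using that complex_Re_le_cmod by metis
  have "Re (trace_mat A) = (\<Sum>i<n. Re (B $$ (i, i)))"
    by (simp add: tr)
  also have "\<dots> \<le> (\<Sum>i<n. 1)" by (intro sum_mono) (use le in auto)
  finally show "Re (trace_mat A) \<le> of_nat n" by simp
  assume n: "Re (trace_mat A) = of_nat n"
  have "(\<Sum>i<n. 1 - Re (B $$ (i, i))) = 0"
    using n by (simp add: tr sum_subtractf)
  then have re: "Re (B $$ (i, i)) = 1" if "i < n" for i
    using sum_nonneg_eq_0_iff[of "{..<n}" "\<lambda>i. 1 - Re (B $$ (i, i))"] le that by force
  \<comment> \<open>Modulus 1 and real part 1 leave no imaginary part.\<close>
  have one: "B $$ (i, i) = 1" if "i < n" for i
    using re[OF that] nrm[OF that] by (simp add: complex_eq_iff cmod_def)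
  have "B = 1\<^sub>m n"
    by (rule upper_triangular_finite_order[OF B(1,2) one Bk k(2)])
  then show "A = 1\<^sub>m n" using w by simp
qed

section \<open>Representations of a group\<close>

lemma subspace_vecI:
  assumes "W \<subseteq> carrier_vec n" "0\<^sub>v n \<in> W"
    "\<And>v w. v \<in> W \<Longrightarrow> w \<in> W \<Longrightarrow> v + w \<in> W" "\<And>c v. v \<in> W \<Longrightarrow> c \<cdot>\<^sub>v v \<in> W"
  shows "VectorSpace.subspace class_ring W (module_vec TYPE(complex) n)"
proof -
  interpret vec_space "TYPE(complex)" n .
  show ?thesis
    unfolding VectorSpace.subspace_def submodule_def
    using assms vectorspace_axioms module_axioms by (auto simp: module_vec_simps)
qed

context group
begin

text \<open>Replaces homomorphisms into \<open>GL n\<close> by plain matrix equations. Conversely,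
  invertibility comes from the group, as \<open>\<rho> (inv g)\<close> inverts
  \<open>\<rho> g\<close>.\<close>

lemma group_rep_iff:
  "group_rep G n \<rho> \<longleftrightarrow> n > 0 \<and> (\<forall>g \<in> carrier G. \<rho> g \<in> carrier_mat n n) \<and> \<rho> \<one> = 1\<^sub>m n \<and>
     (\<forall>g \<in> carrier G. \<forall>h \<in> carrier G. \<rho> (g \<otimes> h) = \<rho> g * \<rho> h)" (is "?L \<longleftrightarrow> ?R")
proof -
  interpret R: ring "ring_mat TYPE(complex) n ()"
    by (rule ring_mat)
  show ?thesis
  proof
    assume L: ?L
    then have hom: "\<rho> \<in> hom G (GL n)" and n: "n > 0" by (auto simp: group_rep_def)
    have "group (GL n)" unfolding GL_def by (rule R.units_group)
    then have "\<rho> \<one> = 1\<^sub>m n"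
      using hom_one[OF hom] by (simp add: GL_def units_of_one ring_mat_simps)
    moreover have "\<rho> g \<in> carrier_mat n n" if "g \<in> carrier G" for g
      using hom_in_carrier[OF hom that] R.Units_closed
      by (auto simp: GL_def units_of_carrier ring_mat_simps)
    moreover have "\<rho> (g \<otimes> h) = \<rho> g * \<rho> h" if "g \<in> carrier G" "h \<in> carrier G" for g h
      using hom_mult[OF hom that] by (simp add: GL_def units_of_mult ring_mat_simps)
    ultimately show ?R using n by blast
  next
    assume R: ?R
    have "\<rho> g \<in> Units (ring_mat TYPE(complex) n ())" if g: "g \<in> carrier G" for g
    proof -
      have "\<rho> g * \<rho> (inv g) = 1\<^sub>m n" "\<rho> (inv g) * \<rho> g = 1\<^sub>m n"
        using R g by (metis inv_closed r_inv, metis inv_closed l_inv)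
      then show ?thesis
        using R g by (auto simp: Units_def ring_mat_simps intro!: bexI[of _ "\<rho> (inv g)"])
    qed
    then show ?L
      using R by (auto simp: group_rep_def hom_def GL_def units_of_carrier units_of_mult ring_mat_simps)
  qed
qed

context
  fixes n :: nat and \<rho> :: "'a \<Rightarrow> complex mat"
  assumes rep: "group_rep G n \<rho>"
begin

lemma rep_pos: "n > 0" and rep_one: "\<rho> \<one> = 1\<^sub>m n"
  using rep by (auto simp: group_rep_iff)

lemma rep_carrier: "g \<in> carrier G \<Longrightarrow> \<rho> g \<in> carrier_mat n n"
  using rep by (auto simp: group_rep_iff)

lemma rep_mult: "g \<in> carrier G \<Longrightarrow> h \<in> carrier G \<Longrightarrow> \<rho> (g \<otimes> h) = \<rho> g * \<rho> h"
  using rep by (auto simp: group_rep_iff)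

lemma rep_mult_vec:
  "g \<in> carrier G \<Longrightarrow> h \<in> carrier G \<Longrightarrow> v \<in> carrier_vec n \<Longrightarrow> \<rho> (g \<otimes> h) *\<^sub>v v = \<rho> g *\<^sub>v (\<rho> h *\<^sub>v v)"
  using rep_carrier rep_mult by (simp add: assoc_mult_mat_vec[of _ n n _ n])

lemma rep_pow: "g \<in> carrier G \<Longrightarrow> \<rho> (g [^] (k :: nat)) = \<rho> g ^\<^sub>m k"
  using rep_carrier rep_one rep_mult by (induction k) auto

lemma trace_rep_one: "trace_mat (\<rho> \<one>) = of_nat n"
  by (simp add: rep_one sum_list_replicate)

text \<open>The order of the group annihilates every element, so \<open>\<rho> g\<close> has finite
  order and the trace bound for such matrices applies.\<close>

lemma finite_rep_trace:
  assumes "finite (carrier G)" "g \<in> carrier G"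
  shows "Re (trace_mat (\<rho> g)) \<le> of_nat n" "Re (trace_mat (\<rho> g)) = of_nat n \<Longrightarrow> \<rho> g = 1\<^sub>m n"
proof -
  have "\<rho> g ^\<^sub>m Coset.order G = 1\<^sub>m n"
    using rep_pow[of g "Coset.order G"] pow_order_eq_1 assms rep_one by simp
  moreover have "Coset.order G > 0"
    using assms by (simp add: order_gt_0_iff_finite)
  ultimately show "Re (trace_mat (\<rho> g)) \<le> of_nat n" "Re (trace_mat (\<rho> g)) = of_nat n \<Longrightarrow> \<rho> g = 1\<^sub>m n"
    using finite_order_trace[OF rep_carrier[OF assms(2)]] by auto
qed

text \<open>In a basis adapted to a proper nonzero invariant subspace all matrices become block
  upper triangular. The diagonal blocks \<open>\<rho>1\<close> and \<open>\<rho>2\<close> are the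
  subrepresentation and the quotient, and traces add up whatever the upper right block is.
  \<open>T\<close>, the first \<open>d\<close> columns of \<open>P\<close>, is the inclusion of the
  subspace.\<close>

lemma reducible_split:
  assumes "\<not> irreducible_rep G n \<rho>"
  obtains d \<rho>1 \<rho>2 T where "0 < d" "d < n" "group_rep G d \<rho>1" "group_rep G (n - d) \<rho>2"
    "\<And>g. g \<in> carrier G \<Longrightarrow> trace_mat (\<rho> g) = trace_mat (\<rho>1 g) + trace_mat (\<rho>2 g)"
    "T \<in> carrier_mat n d" "\<And>g. g \<in> carrier G \<Longrightarrow> \<rho> g * T = T * \<rho>1 g"
    "\<And>v. v \<in> carrier_vec d \<Longrightarrow> T *\<^sub>v v = 0\<^sub>v n \<Longrightarrow> v = 0\<^sub>v d"
proof -
  obtain W where W: "VectorSpace.subspace class_ring W (module_vec TYPE(complex) n)"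
    "\<And>g v. g \<in> carrier G \<Longrightarrow> v \<in> W \<Longrightarrow> \<rho> g *\<^sub>v v \<in> W" "W \<noteq> {0\<^sub>v n}" "W \<noteq> carrier_vec n"
    using assms rep unfolding irreducible_rep_def by blast
  interpret vec_space "TYPE(complex)" n .
  obtain d P Q where d: "0 < d" "d < n" and PQ: "P \<in> carrier_mat n n" "Q \<in> carrier_mat n n"
    "P * Q = 1\<^sub>m n" "Q * P = 1\<^sub>m n"
    and colP: "\<And>j. j < d \<Longrightarrow> col P j \<in> W"
    and Q0: "\<And>v i. v \<in> W \<Longrightarrow> d \<le> i \<Longrightarrow> i < n \<Longrightarrow> (Q *\<^sub>v v) $ i = 0"
    using exists_adapted_basis[OF W(1,3,4)] by blast
  define M where "M g = Q * \<rho> g * P" for g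
  have Mc: "M g \<in> carrier_mat n n" if "g \<in> carrier G" for g
    using that PQ rep_carrier by (auto simp: M_def)
  have PM: "P * M g = \<rho> g * P" if g: "g \<in> carrier G" for g
  proof -
    have "P * M g = (P * Q) * (\<rho> g * P)"
      using PQ(1,2) rep_carrier[OF g] unfolding M_def
      by (simp only: assoc_mult_mat[of _ n n _ n _ n] mult_carrier_mat[of _ n n _ n])
    then show ?thesis using PQ rep_carrier[OF g] by (metis left_mult_one_mat mult_carrier_mat)
  qed
  have Mmult: "M (g \<otimes> h) = M g * M h" if gh: "g \<in> carrier G" "h \<in> carrier G" for g h
  proof -
    note c = rep_carrier[OF gh(1)] rep_carrier[OF gh(2)]
    have "M g * M h = Q * \<rho> g * (P * M h)"
      using PQ c Mc[OF gh(2)] unfolding M_def[of g]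
      by (simp only: assoc_mult_mat[of _ n n _ n _ n] mult_carrier_mat[of _ n n _ n])
    also have "\<dots> = Q * (\<rho> g * \<rho> h) * P"
      unfolding PM[OF gh(2)] using PQ c
      by (simp only: assoc_mult_mat[of _ n n _ n _ n] mult_carrier_mat[of _ n n _ n])
    finally show ?thesis using rep_mult[OF gh] by (simp add: M_def)
  qed
  have M1: "M \<one> = 1\<^sub>m n" using PQ rep_one by (simp add: M_def)
  \<comment> \<open>The lower left block vanishes: \<open>\<rho> g\<close> maps the column
    \<open>col P j\<close> into \<open>W\<close>, and \<open>Q\<close> sends \<open>W\<close> to
    vectors without coordinates from \<open>d\<close> on.\<close>
  have M0: "M g $$ (i, j) = 0" if g: "g \<in> carrier G" and ij: "d \<le> i" "i < n" "j < d" for g i j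
  proof -
    have "M g $$ (i, j) = (M g *\<^sub>v unit_vec n j) $ i"
      using Mc[OF g] ij d by simp
    also have "M g *\<^sub>v unit_vec n j = Q *\<^sub>v (\<rho> g *\<^sub>v col P j)"
    proof -
      have "P *\<^sub>v unit_vec n j = col P j"
        using PQ ij d by (intro eq_vecI) auto
      then show ?thesis
        using PQ rep_carrier[OF g] unfolding M_def
        by (simp add: assoc_mult_mat_vec[of _ n n _ n])
    qed
    also have "\<dots> $ i = 0"
      using Q0[OF W(2)[OF g colP]] ij by simp
    finally show ?thesis .
  qed
  have split: "{..<n} = {..<d} \<union> {d..<n}" using d by auto
  have Msum: "M (g \<otimes> h) $$ (i, j) = (\<Sum>k<n. M g $$ (i, k) * M h $$ (k, j))"
    if "g \<in> carrier G" "h \<in> carrier G" "i < n" "j < n" for g h i j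
    using Mc[of g] Mc[of h] that by (simp add: Mmult scalar_prod_def atLeast0LessThan)
  define \<rho>1 where "\<rho>1 g = mat d d (\<lambda>(i, j). M g $$ (i, j))" for g
  define \<rho>2 where "\<rho>2 g = mat (n - d) (n - d) (\<lambda>(i, j). M g $$ (i + d, j + d))" for g
  define T where "T = mat n d (\<lambda>(i, j). P $$ (i, j))"
  have r1: "group_rep G d \<rho>1"
    unfolding group_rep_iff
  proof (intro conjI ballI)
    fix g h assume gh: "g \<in> carrier G" "h \<in> carrier G"
    show "\<rho>1 (g \<otimes> h) = \<rho>1 g * \<rho>1 h"
    proof (rule eq_matI)
      fix i j assume "i < dim_row (\<rho>1 g * \<rho>1 h)" "j < dim_col (\<rho>1 g * \<rho>1 h)"
      then have ij: "i < d" "j < d" by (auto simp: \<rho>1_def)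
      \<comment> \<open>The zero lower left block of \<open>M h\<close> kills the terms with
        \<open>k \<ge> d\<close>; for \<open>\<rho>2\<close> that of \<open>M g\<close> kills the
        terms with \<open>k < d\<close>.\<close>
      have "M (g \<otimes> h) $$ (i, j) = (\<Sum>k<d. M g $$ (i, k) * M h $$ (k, j))"
        unfolding Msum[OF gh order.strict_trans[OF ij(1) d(2)] order.strict_trans[OF ij(2) d(2)]]
        using d M0[OF gh(2)] ij by (intro sum.mono_neutral_right) auto
      then show "\<rho>1 (g \<otimes> h) $$ (i, j) = (\<rho>1 g * \<rho>1 h) $$ (i, j)"
        using ij by (simp add: \<rho>1_def scalar_prod_def atLeast0LessThan)
    qed (auto simp: \<rho>1_def)
  qed (use d M1 in \<open>auto simp: \<rho>1_def\<close>)
  have r2: "group_rep G (n - d) \<rho>2"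
    unfolding group_rep_iff
  proof (intro conjI ballI)
    fix g h assume gh: "g \<in> carrier G" "h \<in> carrier G"
    show "\<rho>2 (g \<otimes> h) = \<rho>2 g * \<rho>2 h"
    proof (rule eq_matI)
      fix i j assume "i < dim_row (\<rho>2 g * \<rho>2 h)" "j < dim_col (\<rho>2 g * \<rho>2 h)"
      then have ij: "i < n - d" "j < n - d" by (auto simp: \<rho>2_def)
      then have ij': "i + d < n" "j + d < n" by auto
      have "M (g \<otimes> h) $$ (i + d, j + d) = (\<Sum>k\<in>{d..<n}. M g $$ (i + d, k) * M h $$ (k, j + d))"
        unfolding Msum[OF gh ij'] using d M0[OF gh(1)] ij by (intro sum.mono_neutral_right) auto
      also have "\<dots> = (\<Sum>k<n - d. M g $$ (i + d, k + d) * M h $$ (k + d, j + d))"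
        using d by (intro sum.reindex_bij_witness[of _ "\<lambda>k. k + d" "\<lambda>k. k - d"]) auto
      finally show "\<rho>2 (g \<otimes> h) $$ (i, j) = (\<rho>2 g * \<rho>2 h) $$ (i, j)"
        using ij by (simp add: \<rho>2_def scalar_prod_def atLeast0LessThan)
    qed (auto simp: \<rho>2_def)
  qed (use d M1 in \<open>auto simp: \<rho>2_def\<close>)
  have tr: "trace_mat (\<rho> g) = trace_mat (\<rho>1 g) + trace_mat (\<rho>2 g)" if g: "g \<in> carrier G" for g
  proof -
    have "trace_mat (\<rho> g) = (\<Sum>i<n. M g $$ (i, i))"
      using trace_mat_conj[OF rep_carrier[OF g] PQ(1,2,3)] trace_mat_sum[OF Mc[OF g]]
      by (simp add: M_def)
    also have "\<dots> = (\<Sum>i<d. M g $$ (i, i)) + (\<Sum>i\<in>{d..<n}. M g $$ (i, i))"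
      unfolding split by (rule sum.union_disjoint) auto
    also have "(\<Sum>i\<in>{d..<n}. M g $$ (i, i)) = (\<Sum>i<n - d. M g $$ (i + d, i + d))"
      using d by (intro sum.reindex_bij_witness[of _ "\<lambda>k. k + d" "\<lambda>k. k - d"]) auto
    also have "\<dots> = trace_mat (\<rho>2 g)"
      by (subst trace_mat_sum[of _ "n - d"]) (auto simp: \<rho>2_def)
    also have "(\<Sum>i<d. M g $$ (i, i)) = trace_mat (\<rho>1 g)"
      by (subst trace_mat_sum[of _ d]) (auto simp: \<rho>1_def)
    finally show ?thesis .
  qed
  have int: "\<rho> g * T = T * \<rho>1 g" if g: "g \<in> carrier G" for g
  proof (rule eq_matI)
    fix i j assume "i < dim_row (T * \<rho>1 g)" "j < dim_col (T * \<rho>1 g)"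
    then have ij: "i < n" "j < d" by (auto simp: T_def \<rho>1_def)
    have "(\<rho> g * T) $$ (i, j) = (\<rho> g * P) $$ (i, j)"
      using ij d rep_carrier[OF g] PQ by (auto simp: T_def scalar_prod_def)
    also have "\<dots> = (P * M g) $$ (i, j)" by (simp only: PM[OF g])
    also have "\<dots> = (\<Sum>k<n. P $$ (i, k) * M g $$ (k, j))"
      using ij d Mc[OF g] PQ by (simp add: scalar_prod_def atLeast0LessThan)
    also have "\<dots> = (\<Sum>k<d. P $$ (i, k) * M g $$ (k, j))"
      using d M0[OF g] ij by (intro sum.mono_neutral_right) auto
    also have "\<dots> = (T * \<rho>1 g) $$ (i, j)"
      using ij d by (simp add: T_def \<rho>1_def scalar_prod_def atLeast0LessThan)
    finally show "(\<rho> g * T) $$ (i, j) = (T * \<rho>1 g) $$ (i, j)" .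
  qed (use rep_carrier[OF g] in \<open>auto simp: T_def \<rho>1_def\<close>)
  have inj: "v = 0\<^sub>v d" if v: "v \<in> carrier_vec d" "T *\<^sub>v v = 0\<^sub>v n" for v
  proof -
    \<comment> \<open>Padding \<open>v\<close> with zeros turns \<open>T\<close> into
      \<open>P\<close>, so that injectivity of \<open>T\<close> follows from
      \<open>Q * P = 1\<^sub>m n\<close>.\<close>
    define w where "w = vec n (\<lambda>i. if i < d then v $ i else 0)"
    have "P *\<^sub>v w = T *\<^sub>v v"
    proof (rule eq_vecI)
      fix i assume "i < dim_vec (T *\<^sub>v v)"
      then have i: "i < n" by (simp add: T_def)
      have "(P *\<^sub>v w) $ i = (\<Sum>k<n. P $$ (i, k) * w $ k)"
        using PQ i by (simp add: w_def scalar_prod_def atLeast0LessThan)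
      also have "\<dots> = (\<Sum>k<d. P $$ (i, k) * w $ k)"
        using d by (intro sum.mono_neutral_right) (auto simp: w_def)
      also have "\<dots> = (T *\<^sub>v v) $ i"
        using i v(1) d by (simp add: T_def w_def scalar_prod_def atLeast0LessThan)
      finally show "(P *\<^sub>v w) $ i = (T *\<^sub>v v) $ i" .
    qed (use PQ in \<open>auto simp: T_def\<close>)
    then have "Q *\<^sub>v (P *\<^sub>v w) = 0\<^sub>v n" using v PQ by auto
    moreover have "Q *\<^sub>v (P *\<^sub>v w) = w"
      using assoc_mult_mat_vec[OF PQ(2,1), of w] PQ(4) by (simp add: w_def)
    ultimately have w0: "w = 0\<^sub>v n" by simp
    have "v $ i = 0" if "i < d" for i
      using arg_cong[OF w0, of "\<lambda>x. x $ i"] that d by (simp add: w_def)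
    then show ?thesis using v by auto
  qed
  show ?thesis
    by (rule that[OF d r1 r2 tr _ int inj]) (auto simp: T_def)
qed

end

text \<open>Descend to proper subrepresentations and compose the inclusions; composites of injective
  intertwiners are injective intertwiners. \<open>T\<close> embeds the space of
  \<open>\<alpha>\<close> into that of \<open>\<rho>\<close>.\<close>

lemma exists_irreducible_sub:
  assumes "group_rep G n \<rho>"
  shows "\<exists>d \<alpha> T. d \<le> n \<and> irreducible_rep G d \<alpha> \<and> T \<in> carrier_mat n d \<and>
    (\<forall>g \<in> carrier G. \<rho> g * T = T * \<alpha> g) \<and>
    (\<forall>v \<in> carrier_vec d. T *\<^sub>v v = 0\<^sub>v n \<longrightarrow> v = 0\<^sub>v d)"
  using assms
proof (induction n arbitrary: \<rho> rule: less_induct)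
  case (less n)
  show ?case
  proof (cases "irreducible_rep G n \<rho>")
    case True
    have "\<rho> g * 1\<^sub>m n = 1\<^sub>m n * \<rho> g" if "g \<in> carrier G" for g
      using rep_carrier[OF less.prems that] by (metis left_mult_one_mat right_mult_one_mat)
    then show ?thesis
      using True by (intro exI[of _ n] exI[of _ \<rho>] exI[of _ "1\<^sub>m n"]) auto
  next
    case False
    obtain e \<beta> \<beta>' S where "0 < e" and e: "e < n" "group_rep G e \<beta>" and "group_rep G (n - e) \<beta>'"
      "\<And>g. g \<in> carrier G \<Longrightarrow> trace_mat (\<rho> g) = trace_mat (\<beta> g) + trace_mat (\<beta>' g)"
      and S: "S \<in> carrier_mat n e"
      "\<And>g. g \<in> carrier G \<Longrightarrow> \<rho> g * S = S * \<beta> g"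
      "\<And>v. v \<in> carrier_vec e \<Longrightarrow> S *\<^sub>v v = 0\<^sub>v n \<Longrightarrow> v = 0\<^sub>v e"
      by (rule reducible_split[OF less.prems False]; rule that)
    obtain d \<alpha> T where d: "d \<le> e" "irreducible_rep G d \<alpha>" and T: "T \<in> carrier_mat e d"
      "\<And>g. g \<in> carrier G \<Longrightarrow> \<beta> g * T = T * \<alpha> g"
      "\<And>v. v \<in> carrier_vec d \<Longrightarrow> T *\<^sub>v v = 0\<^sub>v e \<Longrightarrow> v = 0\<^sub>v d"
      using less.IH[OF e] by blast
    have "\<rho> g * (S * T) = S * T * \<alpha> g" if g: "g \<in> carrier G" for g
    proof -
      note c = rep_carrier[OF less.prems g] rep_carrier[OF e(2) g]
      have \<alpha>: "\<alpha> g \<in> carrier_mat d d"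
        using d(2) g rep_carrier by (auto simp: irreducible_rep_def)
      have "\<rho> g * (S * T) = \<rho> g * S * T"
        using assoc_mult_mat[OF c(1) S(1) T(1)] by simp
      also have "\<dots> = S * (\<beta> g * T)"
        unfolding S(2)[OF g] by (rule assoc_mult_mat[OF S(1) c(2) T(1)])
      also have "\<dots> = S * T * \<alpha> g"
        unfolding T(2)[OF g] using assoc_mult_mat[OF S(1) T(1) \<alpha>] by simp
      finally show ?thesis .
    qed
    moreover have "v = 0\<^sub>v d" if "v \<in> carrier_vec d" "S * T *\<^sub>v v = 0\<^sub>v n" for v
      using that S(3)[of "T *\<^sub>v v"] T(1,3) assoc_mult_mat_vec[OF S(1) T(1) that(1)] by simp
    ultimately show ?thesis
      using d e S(1) T(1) by (intro exI[of _ d] exI[of _ \<alpha>] exI[of _ "S * T"]) auto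
  qed
qed

text \<open>Repeated splitting lists the composition factors with multiplicity; only degrees and
  traces are kept, which is what determines the character.\<close>

lemma irreducible_decomposition:
  assumes "group_rep G n \<rho>"
  shows "\<exists>xs. (\<forall>(m, \<sigma>) \<in> set xs. irreducible_rep G m \<sigma>) \<and> n = (\<Sum>(m, \<sigma>)\<leftarrow>xs. m) \<and>
    (\<forall>g \<in> carrier G. trace_mat (\<rho> g) = (\<Sum>(m, \<sigma>)\<leftarrow>xs. trace_mat (\<sigma> g)))"
  using assms
proof (induction n arbitrary: \<rho> rule: less_induct)
  case (less n)
  show ?case
  proof (cases "irreducible_rep G n \<rho>")
    case True
    then show ?thesis by (intro exI[of _ "[(n, \<rho>)]"]) auto
  next
    case False
    obtain d \<rho>1 \<rho>2 where d: "0 < d" "d < n" "group_rep G d \<rho>1" "group_rep G (n - d) \<rho>2"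
      "\<And>g. g \<in> carrier G \<Longrightarrow> trace_mat (\<rho> g) = trace_mat (\<rho>1 g) + trace_mat (\<rho>2 g)"
      using reducible_split[OF less.prems False] by metis
    obtain xs where "\<forall>(m, \<sigma>) \<in> set xs. irreducible_rep G m \<sigma>" "d = (\<Sum>(m, \<sigma>)\<leftarrow>xs. m)"
      "\<forall>g \<in> carrier G. trace_mat (\<rho>1 g) = (\<Sum>(m, \<sigma>)\<leftarrow>xs. trace_mat (\<sigma> g))"
      using less.IH[OF d(2,3)] by auto
    moreover obtain ys where "\<forall>(m, \<sigma>) \<in> set ys. irreducible_rep G m \<sigma>"
      "n - d = (\<Sum>(m, \<sigma>)\<leftarrow>ys. m)"
      "\<forall>g \<in> carrier G. trace_mat (\<rho>2 g) = (\<Sum>(m, \<sigma>)\<leftarrow>ys. trace_mat (\<sigma> g))"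
      using less.IH[OF _ d(4)] d(1,2) by auto
    ultimately show ?thesis
      using d(2,5) by (intro exI[of _ "xs @ ys"]) auto
  qed
qed

text \<open>Schur's lemma for central elements: an eigenspace of \<open>\<rho> z\<close> is nonzero
  and invariant, hence the whole space.\<close>

lemma irreducible_center_scalar:
  assumes irr: "irreducible_rep G n \<rho>" and z: "z \<in> group_center G"
  obtains c where "\<rho> z = c \<cdot>\<^sub>m 1\<^sub>m n"
proof -
  have rep: "group_rep G n \<rho>" using irr by (simp add: irreducible_rep_def)
  have zG: "z \<in> carrier G" using z by (simp add: group_center_def)
  note zc = rep_carrier[OF rep zG]
  have "spectrum (\<rho> z) \<noteq> {}"
    using spectrum_non_empty[OF zc] rep_pos[OF rep] by simp
  then obtain c v where v: "eigenvector (\<rho> z) v c"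
    by (auto simp: spectrum_def eigenvalue_def)
  define W where "W = {v \<in> carrier_vec n. \<rho> z *\<^sub>v v = c \<cdot>\<^sub>v v}"
  have "VectorSpace.subspace class_ring W (module_vec TYPE(complex) n)"
    using zc by (intro subspace_vecI)
      (auto simp: W_def mult_add_distrib_mat_vec[of _ n n] mult_mat_vec[of _ n n]
        smult_add_distrib_vec[of _ n] smult_smult_assoc mult.commute)
  moreover have "\<rho> g *\<^sub>v w \<in> W" if g: "g \<in> carrier G" and w: "w \<in> W" for g w
  proof -
    have wc: "w \<in> carrier_vec n" using w by (simp add: W_def)
    have "\<rho> z *\<^sub>v (\<rho> g *\<^sub>v w) = \<rho> (g \<otimes> z) *\<^sub>v w"
      using rep_mult_vec[OF rep zG g wc] z g by (simp add: group_center_def)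
    also have "\<dots> = c \<cdot>\<^sub>v (\<rho> g *\<^sub>v w)"
      using rep_mult_vec[OF rep g zG wc] w rep_carrier[OF rep g]
      by (simp add: W_def mult_mat_vec[of _ n n])
    finally show ?thesis using rep_carrier[OF rep g] wc by (simp add: W_def)
  qed
  moreover have "v \<in> W" "v \<noteq> 0\<^sub>v n" using v zc by (auto simp: W_def eigenvector_def)
  ultimately have W: "W = carrier_vec n"
    using irr unfolding irreducible_rep_def by blast
  have "\<rho> z = c \<cdot>\<^sub>m 1\<^sub>m n"
  proof (rule eq_matI)
    fix i j assume "i < dim_row (c \<cdot>\<^sub>m 1\<^sub>m n)" "j < dim_col (c \<cdot>\<^sub>m 1\<^sub>m n)"
    then have ij: "i < n" "j < n" by auto
    have "unit_vec n j \<in> W" using W by simp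
    then have "\<rho> z *\<^sub>v unit_vec n j = c \<cdot>\<^sub>v unit_vec n j" by (simp add: W_def)
    from arg_cong[OF this, of "\<lambda>x. x $ i"]
    show "\<rho> z $$ (i, j) = (c \<cdot>\<^sub>m 1\<^sub>m n) $$ (i, j)" using ij zc by (simp add: index_unit_vec)
  qed (use zc in auto)
  then show ?thesis by (rule that)
qed

section \<open>Abelian subgroups and bounds on irreducible degrees\<close>

lemma group_rep_subgroup:
  assumes "subgroup N G" "group_rep G n \<rho>"
  shows "group_rep (G\<lparr>carrier := N\<rparr>) n \<rho>"
  using assms subgroup.subset[OF assms(1)] by (auto simp: group_rep_def hom_def)

text \<open>In the restriction to \<open>N\<close> choose an irreducible subrepresentation. Every
  element of \<open>N\<close> is central in \<open>N\<close> and acts on it by a scalar, so the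
  image under \<open>T\<close> of any nonzero vector is a common eigenvector.\<close>

lemma abelian_subgroup_eigenvector:
  assumes N: "subgroup N G" and ab: "\<And>a b. a \<in> N \<Longrightarrow> b \<in> N \<Longrightarrow> a \<otimes> b = b \<otimes> a"
    and rep: "group_rep G n \<rho>"
  obtains v where "v \<in> carrier_vec n" "v \<noteq> 0\<^sub>v n" "\<And>a. a \<in> N \<Longrightarrow> \<exists>c. \<rho> a *\<^sub>v v = c \<cdot>\<^sub>v v"
proof -
  interpret N: group "G\<lparr>carrier := N\<rparr>" by (rule subgroup_imp_group[OF N])
  obtain d \<alpha> T where d: "irreducible_rep (G\<lparr>carrier := N\<rparr>) d \<alpha>" and T: "T \<in> carrier_mat n d"
      "\<And>g. g \<in> N \<Longrightarrow> \<rho> g * T = T * \<alpha> g"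
      "\<And>v. v \<in> carrier_vec d \<Longrightarrow> T *\<^sub>v v = 0\<^sub>v n \<Longrightarrow> v = 0\<^sub>v d"
    using N.exists_irreducible_sub[OF group_rep_subgroup[OF N rep]] by auto
  have r: "group_rep (G\<lparr>carrier := N\<rparr>) d \<alpha>" using d by (simp add: irreducible_rep_def)
  have d0: "d > 0" using N.rep_pos[OF r] .
  define u :: "complex vec" where "u = unit_vec d 0"
  have u: "u \<in> carrier_vec d" by (simp add: u_def)
  have "u $ 0 \<noteq> 0\<^sub>v d $ 0" using d0 by (simp add: u_def)
  then have u0: "u \<noteq> 0\<^sub>v d" by auto
  show ?thesis
  proof (rule that[of "T *\<^sub>v u"])
    show "T *\<^sub>v u \<in> carrier_vec n" using T(1) u by auto
    show "T *\<^sub>v u \<noteq> 0\<^sub>v n" using T(3)[OF u] u0 by auto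
    fix a assume a: "a \<in> N"
    then have "a \<in> group_center (G\<lparr>carrier := N\<rparr>)"
      using ab by (simp add: group_center_def)
    then obtain c where c: "\<alpha> a = c \<cdot>\<^sub>m 1\<^sub>m d"
      using N.irreducible_center_scalar[OF d] by blast
    have aG: "a \<in> carrier G" using a subgroup.subset[OF N] by auto
    have scalar_mat: "(c \<cdot>\<^sub>m 1\<^sub>m d) *\<^sub>v u = c \<cdot>\<^sub>v u"
      using u by (intro eq_vecI) (auto simp: u_def index_unit_vec)
    have "\<rho> a *\<^sub>v (T *\<^sub>v u) = (T * \<alpha> a) *\<^sub>v u"
      using assoc_mult_mat_vec[OF rep_carrier[OF rep aG] T(1) u] T(2)[OF a] by simp
    also have "\<dots> = T *\<^sub>v (c \<cdot>\<^sub>v u)"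
      using assoc_mult_mat_vec[OF T(1) _ u, of "\<alpha> a"] N.rep_carrier[OF r] a u
      by (simp add: c scalar_mat)
    also have "\<dots> = c \<cdot>\<^sub>v (T *\<^sub>v u)" by (rule mult_mat_vec[OF T(1) u])
    finally show "\<exists>c. \<rho> a *\<^sub>v (T *\<^sub>v u) = c \<cdot>\<^sub>v (T *\<^sub>v u)" by blast
  qed
qed

text \<open>
  For a common eigenvector \<open>v\<close> of \<open>N\<close>, the line through \<open>\<rho> g v\<close> depends only on the coset \<open>g N\<close>, so
  \<open>v\<close> generates a submodule of dimension at most the index of \<open>N\<close>. Left cosets are obtained from
  right cosets by inversion.
\<close>

lemma irreducible_degree_le_index:
  assumes irr: "irreducible_rep G n \<rho>" and finG: "finite (carrier G)"
    and N: "subgroup N G" and ab: "\<And>a b. a \<in> N \<Longrightarrow> b \<in> N \<Longrightarrow> a \<otimes> b = b \<otimes> a"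
  shows "n \<le> card (rcosets N)"
proof -
  interpret vec_space "TYPE(complex)" n .
  have rep: "group_rep G n \<rho>" using irr by (simp add: irreducible_rep_def)
  obtain v where v: "v \<in> carrier_vec n" "v \<noteq> 0\<^sub>v n" "\<And>a. a \<in> N \<Longrightarrow> \<exists>c. \<rho> a *\<^sub>v v = c \<cdot>\<^sub>v v"
    using abelian_subgroup_eigenvector[OF N ab rep] by blast
  define f where "f X = \<rho> (inv (SOME x. x \<in> X)) *\<^sub>v v" for X
  define S where "S = f ` (rcosets N)"
  have some: "(SOME x. x \<in> N #> x') \<in> N #> x'" if "x' \<in> carrier G" for x'
    using someI[of "\<lambda>x. x \<in> N #> x'" x'] rcos_self[OF that N] by simp
  have Sc: "S \<subseteq> carrier_vec n"
  proof
    fix w assume "w \<in> S"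
    then obtain x where x: "x \<in> carrier G" "w = f (N #> x)"
      by (auto simp: S_def RCOSETS_def)
    have "(SOME y. y \<in> N #> x) \<in> carrier G"
      using some[OF x(1)] r_coset_subset_G[OF subgroup.subset[OF N] x(1)] by blast
    then show "w \<in> carrier_vec n"
      using x rep_carrier[OF rep] v(1) by (auto simp: f_def intro!: mult_mat_vec_carrier)
  qed
  have finR: "finite (rcosets N)"
    using finG by (simp add: RCOSETS_def)
  then have Sfin: "finite S" by (simp add: S_def)
  have sub: "submodule class_ring (span S) V"
    using span_is_submodule[of S] Sc by simp
  \<comment> \<open>The vectors whose whole orbit stays in \<open>span S\<close> form an invariant
    subspace by construction. Once it contains \<open>v\<close>, irreducibility makes it everything,
    and the orbit element at the identity shows that \<open>S\<close> spans.\<close>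
  define W where "W = {w \<in> carrier_vec n. \<forall>g \<in> carrier G. \<rho> g *\<^sub>v w \<in> span S}"
  have "VectorSpace.subspace class_ring W V"
  proof (rule subspace_vecI)
    have "\<rho> g *\<^sub>v 0\<^sub>v n = 0\<^sub>v n" if "g \<in> carrier G" for g
      using rep_carrier[OF rep that] by (intro eq_vecI) auto
    then show "0\<^sub>v n \<in> W" using submodule.zero_closed[OF sub]
      by (simp add: W_def module_vec_simps)
    show "x + y \<in> W" if "x \<in> W" "y \<in> W" for x y
      using that rep_carrier[OF rep] submodule.m_closed[OF sub]
      by (auto simp: W_def module_vec_simps mult_add_distrib_mat_vec[of _ n n])
    show "c \<cdot>\<^sub>v x \<in> W" if "x \<in> W" for c x
      using that rep_carrier[OF rep] submodule.smult_closed[OF sub]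
      by (auto simp: W_def module_vec_simps mult_mat_vec[of _ n n])
  qed (auto simp: W_def)
  moreover have "\<rho> h *\<^sub>v w \<in> W" if h: "h \<in> carrier G" and w: "w \<in> W" for h w
  proof -
    have "\<rho> g *\<^sub>v (\<rho> h *\<^sub>v w) \<in> span S" if g: "g \<in> carrier G" for g
    proof -
      have "w \<in> carrier_vec n" "\<rho> (g \<otimes> h) *\<^sub>v w \<in> span S"
        using w g h by (simp_all add: W_def)
      then show ?thesis using rep_mult_vec[OF rep g h] by metis
    qed
    then show ?thesis using rep_carrier[OF rep h] w by (auto simp: W_def)
  qed
  moreover have "v \<in> W"
  proof -
    have "\<rho> g *\<^sub>v v \<in> span S" if g: "g \<in> carrier G" for g
    proof -
      have ig: "inv g \<in> carrier G" using g by simp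
      define y where "y = (SOME x. x \<in> N #> inv g)"
      have fy: "f (N #> inv g) = \<rho> (inv y) *\<^sub>v v" by (simp add: f_def y_def)
      have "y \<in> N #> inv g" using some[OF ig] by (simp add: y_def)
      then obtain a where a: "a \<in> N" "y = a \<otimes> inv g" by (auto simp: r_coset_def)
      have aG: "a \<in> carrier G" using a subgroup.subset[OF N] by auto
      have yG: "y \<in> carrier G" using a aG ig by simp
      \<comment> \<open>The chosen representative is \<open>y = a \<otimes> inv g\<close>, so
        \<open>g\<close> and \<open>inv y\<close> differ by \<open>a\<close>, which only rescales
        \<open>v\<close>.\<close>
      have "inv y \<otimes> a = g \<otimes> (inv a \<otimes> a)"
        using a aG g by (simp add: inv_mult_group m_assoc)
      then have g_eq: "inv y \<otimes> a = g" using aG g by simp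
      obtain c where "\<rho> a *\<^sub>v v = c \<cdot>\<^sub>v v" using v(3)[OF a(1)] by blast
      then have "\<rho> (inv y \<otimes> a) *\<^sub>v v = c \<cdot>\<^sub>v (\<rho> (inv y) *\<^sub>v v)"
        using rep_mult_vec[OF rep _ aG v(1), of "inv y"] yG rep_carrier[OF rep, of "inv y"] v(1)
        by (simp add: mult_mat_vec[of _ n n])
      then have "\<rho> g *\<^sub>v v = c \<cdot>\<^sub>v f (N #> inv g)"
        unfolding g_eq fy .
      moreover have "f (N #> inv g) \<in> S"
        using ig by (auto simp: S_def RCOSETS_def)
      then have "f (N #> inv g) \<in> span S"
        using span_mem[OF Sc] by blast
      ultimately show ?thesis
        using submodule.smult_closed[OF sub, of c] by (simp add: module_vec_simps)
    qed
    then show ?thesis using v by (simp add: W_def)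
  qed
  ultimately have W: "W = carrier_vec n"
    using irr v(2) unfolding irreducible_rep_def by blast
  have "w \<in> span S" if "w \<in> carrier_vec n" for w
  proof -
    have "\<rho> \<one> *\<^sub>v w \<in> span S" using that W by (auto simp: W_def)
    then show ?thesis using rep_one[OF rep] that by simp
  qed
  then have "span S = carrier_vec n"
    using span_is_subset2[OF Sc] by auto
  then have "n \<le> card S"
    using gen_ge_dim[OF Sfin] Sc dim_is_n by simp
  also have "\<dots> \<le> card (rcosets N)" unfolding S_def by (rule card_image_le[OF finR])
  finally show ?thesis .
qed

text \<open>The permutation matrices of left translation: the trace counts fixed points, and a
  nontrivial translation has none. It serves to find an irreducible representation in which a given
  element acts nontrivially.\<close>

lemma exists_regular_rep:
  assumes fin: "finite (carrier G)"
  obtains n \<rho> where "group_rep G n \<rho>"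
    "\<And>g. g \<in> carrier G \<Longrightarrow> g \<noteq> \<one> \<Longrightarrow> trace_mat (\<rho> g) = 0"
proof -
  define n where "n = Coset.order G"
  obtain e where e: "bij_betw e {..<n} (carrier G)"
    using ex_bij_betw_nat_finite[OF fin] by (auto simp: n_def Coset.order_def atLeast0LessThan)
  have ec: "e i \<in> carrier G" if "i < n" for i
    using bij_betwE[OF e] that by auto
  have inj: "e i = e j \<longleftrightarrow> i = j" if "i < n" "j < n" for i j
    using bij_betw_imp_inj_on[OF e] that by (auto simp: inj_on_def)
  define \<rho> where "\<rho> g = mat n n (\<lambda>(i, j). if e i = g \<otimes> e j then 1 else 0 :: complex)" for g
  have n0: "n > 0" using fin by (simp add: n_def order_gt_0_iff_finite)
  have "group_rep G n \<rho>"
    unfolding group_rep_iff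
  proof (intro conjI ballI)
    show "\<rho> \<one> = 1\<^sub>m n"
      using ec inj by (intro eq_matI) (auto simp: \<rho>_def)
    fix g h assume gh: "g \<in> carrier G" "h \<in> carrier G"
    show "\<rho> (g \<otimes> h) = \<rho> g * \<rho> h"
    proof (rule eq_matI)
      fix i j assume "i < dim_row (\<rho> g * \<rho> h)" "j < dim_col (\<rho> g * \<rho> h)"
      then have ij: "i < n" "j < n" by (auto simp: \<rho>_def)
      have "h \<otimes> e j \<in> carrier G" using gh ec ij by simp
      then obtain k where k: "k < n" "e k = h \<otimes> e j"
        using bij_betw_imp_surj_on[OF e] by (metis imageE lessThan_iff)
      have "(\<rho> g * \<rho> h) $$ (i, j) =
          (\<Sum>l<n. (if e i = g \<otimes> e l then 1 else 0) * (if e l = h \<otimes> e j then 1 else 0))"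
        using ij by (simp add: \<rho>_def scalar_prod_def atLeast0LessThan)
      also have "\<dots> = (\<Sum>l<n. if l = k then (if e i = g \<otimes> e k then 1 else 0) else 0)"
        using k inj by (intro sum.cong) (auto simp flip: k(2))
      also have "\<dots> = (if e i = g \<otimes> h \<otimes> e j then 1 else 0)"
        using k gh ec ij by (simp add: m_assoc)
      finally show "\<rho> (g \<otimes> h) $$ (i, j) = (\<rho> g * \<rho> h) $$ (i, j)"
        using ij by (simp add: \<rho>_def)
    qed (auto simp: \<rho>_def)
  qed (use n0 in \<open>auto simp: \<rho>_def\<close>)
  moreover have "trace_mat (\<rho> g) = 0" if g: "g \<in> carrier G" "g \<noteq> \<one>" for g
  proof -
    have "e i \<noteq> g \<otimes> e i" if "i < n" for i
      using g ec[OF that] by (metis r_cancel_one)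
    then show ?thesis
      by (subst trace_mat_sum[of _ n]) (auto simp: \<rho>_def)
  qed
  ultimately show ?thesis by (rule that)
qed

lemma group_rep_direct_sum:
  assumes \<rho>: "group_rep G n \<rho>" and \<sigma>: "group_rep G m \<sigma>"
  shows "group_rep G (n + m) (\<lambda>g. four_block_mat (\<rho> g) (0\<^sub>m n m) (0\<^sub>m m n) (\<sigma> g))"
  unfolding group_rep_iff
proof (intro conjI ballI)
  show "four_block_mat (\<rho> \<one>) (0\<^sub>m n m) (0\<^sub>m m n) (\<sigma> \<one>) = 1\<^sub>m (n + m)"
    using rep_one[OF \<rho>] rep_one[OF \<sigma>] by simp
  fix g assume g: "g \<in> carrier G"
  note c = rep_carrier[OF \<rho> g] rep_carrier[OF \<sigma> g]
  show "four_block_mat (\<rho> g) (0\<^sub>m n m) (0\<^sub>m m n) (\<sigma> g) \<in> carrier_mat (n + m) (n + m)"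
    using c by auto
  fix h assume h: "h \<in> carrier G"
  note c' = rep_carrier[OF \<rho> h] rep_carrier[OF \<sigma> h]
  show "four_block_mat (\<rho> (g \<otimes> h)) (0\<^sub>m n m) (0\<^sub>m m n) (\<sigma> (g \<otimes> h)) =
      four_block_mat (\<rho> g) (0\<^sub>m n m) (0\<^sub>m m n) (\<sigma> g) * four_block_mat (\<rho> h) (0\<^sub>m n m) (0\<^sub>m m n) (\<sigma> h)"
    using c c' rep_mult[OF \<rho> g h] rep_mult[OF \<sigma> g h]
    by (subst mult_four_block_mat[of _ n n _ m _ m _ _ n _ m]) auto
qed (use rep_pos[OF \<rho>] in simp)

end

section \<open>Finite p-groups with cyclic center\<close>

text \<open>Class counting: \<open>N\<close> without the identity is a union of conjugacy classes.
  If none of its elements were central, all these classes would have size divisible by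
  \<open>p\<close>, so \<open>p\<close> would divide both \<open>card N - 1\<close> and
  \<open>card N\<close>.\<close>

lemma p_group_normal_meets_center:
  fixes G (structure)
  assumes p: "prime p" and G: "finite_p_group p G" and N: "N \<lhd> G" and N1: "N \<noteq> {\<one>}"
  shows "\<exists>x \<in> N. x \<noteq> \<one> \<and> x \<in> group_center G"
proof (rule ccontr)
  assume "\<not> ?thesis"
  then have none: "x \<notin> group_center G" if "x \<in> N" "x \<noteq> \<one>" for x
    using that by blast
  interpret group G using G by (simp add: finite_p_group_def)
  obtain n where fin: "finite (carrier G)" and n: "card (carrier G) = p ^ n"
    using G by (auto simp: finite_p_group_def)
  have sub: "subgroup N G" and conjN: "\<And>g x. g \<in> carrier G \<Longrightarrow> x \<in> N \<Longrightarrow> g \<otimes> x \<otimes> inv g \<in> N"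
    using N by (auto simp: normal_inv_iff)
  have NG: "N \<subseteq> carrier G" by (rule subgroup.subset[OF sub])
  define cj where "cj = (\<lambda>g. \<lambda>h \<in> carrier G. g \<otimes> h \<otimes> inv g)"
  interpret act: group_action G "carrier G" cj
    unfolding cj_def by (rule action_by_conjugation)
  have orb: "orbit G cj x = (\<lambda>g. g \<otimes> x \<otimes> inv g) ` carrier G" if "x \<in> N" for x
    using that NG by (auto simp: orbit_def cj_def)
  \<comment> \<open>Orbit sizes divide \<open>p ^ n\<close>, so the only alternative is an orbit of
    size one, which means that \<open>x\<close> is central.\<close>
  have p_dvd: "p dvd card (orbit G cj x)" if x: "x \<in> N - {\<one>}" for x
  proof (rule ccontr)
    assume nd: "\<not> ?thesis"
    have xG: "x \<in> carrier G" using x NG by auto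
    have "card (orbit G cj x) dvd p ^ n"
      using act.orbit_stabilizer_theorem[OF xG] n by (metis Coset.order_def dvd_triv_left)
    then obtain k where "card (orbit G cj x) = p ^ k"
      using divides_primepow_nat[OF p] by blast
    with nd have "card (orbit G cj x) = 1" by (cases k) auto
    then obtain y where "orbit G cj x = {y}" by (rule card_1_singletonE)
    then have one: "orbit G cj x = {x}" using act.orbit_refl[OF xG] by auto
    have "x \<otimes> g = g \<otimes> x" if g: "g \<in> carrier G" for g
    proof -
      have "g \<otimes> x \<otimes> inv g = x" using one orb[of x] x g by auto
      then show ?thesis using g xG by (metis inv_solve_right m_closed)
    qed
    then have "x \<in> group_center G" using xG by (simp add: group_center_def)
    then show False using none x by auto
  qed
  have un: "\<Union> (orbit G cj ` (N - {\<one>})) = N - {\<one>}"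
  proof
    show "\<Union> (orbit G cj ` (N - {\<one>})) \<subseteq> N - {\<one>}"
    proof
      fix y assume "y \<in> \<Union> (orbit G cj ` (N - {\<one>}))"
      then obtain x g where x: "x \<in> N" "x \<noteq> \<one>" "g \<in> carrier G" "y = g \<otimes> x \<otimes> inv g"
        using orb by auto
      have "y \<noteq> \<one>"
      proof
        assume "y = \<one>"
        then have "g \<otimes> x = g" using x NG by (metis inv_solve_right l_one m_closed one_closed subsetD)
        then show False using x NG by (metis r_cancel_one' subsetD l_cancel_one)
      qed
      then show "y \<in> N - {\<one>}" using conjN x by auto
    qed
    show "N - {\<one>} \<subseteq> \<Union> (orbit G cj ` (N - {\<one>}))"
      using act.orbit_refl NG by auto
  qed
  have finN: "finite N" using NG fin finite_subset by auto
  have "p dvd card (\<Union> (orbit G cj ` (N - {\<one>})))"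
  proof (rule dvd_partition)
    show "finite (\<Union> (orbit G cj ` (N - {\<one>})))" unfolding un using finN by simp
    show "\<forall>c\<in>orbit G cj ` (N - {\<one>}). p dvd card c" using p_dvd by auto
    show "\<forall>c1\<in>orbit G cj ` (N - {\<one>}). \<forall>c2\<in>orbit G cj ` (N - {\<one>}). c1 \<noteq> c2 \<longrightarrow> c1 \<inter> c2 = {}"
    proof (intro ballI impI)
      fix c1 c2 assume c: "c1 \<in> orbit G cj ` (N - {\<one>})" "c2 \<in> orbit G cj ` (N - {\<one>})" "c1 \<noteq> c2"
      have "c1 \<in> orbits G (carrier G) cj" "c2 \<in> orbits G (carrier G) cj"
        using c NG by (auto simp: orbits_def)
      then show "c1 \<inter> c2 = {}" using act.disjoint_union c(3) by blast
    qed
  qed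
  then have "p dvd card N - 1"
    unfolding un using finN subgroup.one_closed[OF sub] by (simp add: card_Diff_singleton)
  moreover have "p dvd card N"
  proof -
    have "card N dvd p ^ n"
      using lagrange[OF sub] n by (metis Coset.order_def dvd_triv_right)
    then obtain k where k: "card N = p ^ k"
      using divides_primepow_nat[OF p] by blast
    have "k \<noteq> 0"
    proof
      assume "k = 0"
      then obtain y where "N = {y}" using k by (metis card_1_singletonE power_0)
      then show False using subgroup.one_closed[OF sub] N1 by auto
    qed
    then show ?thesis using k by (simp add: dvd_power)
  qed
  moreover have "card N \<ge> 1"
    using finN subgroup.one_closed[OF sub] by (metis One_nat_def Suc_leI card_gt_0_iff empty_iff)
  ultimately have "p dvd 1" by (metis dvd_diffD1)
  then show False using p by (simp add: prime_nat_iff)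
qed

lemma (in group) subgroup_group_center: "subgroup (group_center G) G"
proof (rule subgroupI)
  show "inv a \<in> group_center G" if a: "a \<in> group_center G" for a
  proof -
    have "inv a \<otimes> g = g \<otimes> inv a" if g: "g \<in> carrier G" for g
    proof -
      have aG: "a \<in> carrier G" and ag: "a \<otimes> g = g \<otimes> a"
        using a g by (auto simp: group_center_def)
      have "inv a \<otimes> g = inv a \<otimes> (g \<otimes> a) \<otimes> inv a" using aG g by (simp add: m_assoc)
      also have "\<dots> = inv a \<otimes> a \<otimes> g \<otimes> inv a"
        unfolding ag[symmetric] using aG g by (simp only: m_assoc m_closed inv_closed)
      finally show ?thesis using aG g by simp
    qed
    then show ?thesis using a by (simp add: group_center_def)
  qed
  show "a \<otimes> b \<in> group_center G" if "a \<in> group_center G" "b \<in> group_center G" for a b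
  proof -
    have ab: "a \<in> carrier G" "b \<in> carrier G" using that by (auto simp: group_center_def)
    have "a \<otimes> b \<otimes> g = g \<otimes> (a \<otimes> b)" if g: "g \<in> carrier G" for g
    proof -
      have "a \<otimes> b \<otimes> g = a \<otimes> (g \<otimes> b)"
        using \<open>b \<in> group_center G\<close> ab g by (simp add: m_assoc group_center_def)
      also have "\<dots> = a \<otimes> g \<otimes> b" using ab g by (simp add: m_assoc)
      also have "\<dots> = g \<otimes> a \<otimes> b" using \<open>a \<in> group_center G\<close> g by (simp add: group_center_def)
      finally show ?thesis using ab g by (simp add: m_assoc)
    qed
    then show ?thesis using ab by (simp add: group_center_def)
  qed
qed (auto simp: group_center_def)

text \<open>\<open>z\<close> generates the subgroup of order \<open>p\<close> of the center. In a
  cyclic \<open>p\<close>-group this subgroup lies in every nontrivial subgroup, so each nontrivial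
  central element has \<open>z\<close> among its powers.\<close>

lemma p_group_cyclic_center:
  fixes G (structure)
  assumes p: "prime p" and G: "finite_p_group p G" and nt: "\<not> trivial_group G"
    and cyc: "cyclic_group (G\<lparr>carrier := group_center G\<rparr>)"
  obtains z where "z \<in> group_center G" "z \<noteq> \<one>" "z [^] p = \<one>"
    "\<And>x. x \<in> group_center G \<Longrightarrow> x \<noteq> \<one> \<Longrightarrow> \<exists>k::nat. x [^] k = z"
proof -
  interpret group G using G by (simp add: finite_p_group_def)
  obtain n where fin: "finite (carrier G)" and n: "card (carrier G) = p ^ n"
    using G by (auto simp: finite_p_group_def)
  let ?Z = "group_center G"
  interpret Z: group "G\<lparr>carrier := ?Z\<rparr>"
    by (rule subgroup_imp_group[OF subgroup_group_center])
  \<comment> \<open>Applied to the whole group, the intersection lemma shows that the center is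
    nontrivial.\<close>
  have "carrier G \<lhd> G"
    by (auto simp: normal_inv_iff subgroup_self)
  then obtain x where x: "x \<noteq> \<one>" "x \<in> ?Z"
    using p_group_normal_meets_center[OF p G, of "carrier G"] nt
    by (metis is_group trivial_group_def)
  obtain c where c: "c \<in> ?Z"
    and c_gen: "carrier (G\<lparr>carrier := ?Z\<rparr>) = range (\<lambda>i::int. c [^]\<^bsub>G\<lparr>carrier := ?Z\<rparr>\<^esub> i)"
    using cyc unfolding Z.cyclic_group by auto
  have cG: "c \<in> carrier G" using c by (simp add: group_center_def)
  \<comment> \<open>Integer exponents are reduced modulo \<open>ord c\<close>, so natural powers of
    the generator suffice.\<close>
  have gen: "\<exists>t::nat. y = c [^] t" if "y \<in> ?Z" for y
  proof -
    have "y \<in> carrier (G\<lparr>carrier := ?Z\<rparr>)" using that by simp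
    then obtain i :: int where "y = c [^]\<^bsub>G\<lparr>carrier := ?Z\<rparr>\<^esub> i"
      unfolding c_gen by (rule rangeE)
    then have y: "y = c [^] i"
      using int_pow_consistent[OF subgroup_group_center c] by simp
    have "ord c > 0" using ord_ge_1[OF fin cG] by simp
    then have "c [^] i = c [^] (i mod int (ord c))"
      using int_pow_eq[OF cG] by (simp add: mod_eq_dvd_iff[symmetric])
    also have "\<dots> = c [^] nat (i mod int (ord c))"
      using \<open>ord c > 0\<close> by (simp add: int_pow_def2)
    finally show ?thesis using y by blast
  qed
  have "ord c dvd p ^ n"
    using ord_dvd_group_order[OF cG] n by (simp add: Coset.order_def)
  then obtain m where m: "ord c = p ^ m"
    using divides_primepow_nat[OF p] by blast
  have "m \<noteq> 0"
  proof
    assume "m = 0"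
    then have "c = \<one>" using m pow_ord_eq_1[OF cG] cG by simp
    then show False using gen[OF x(2)] x(1) by auto
  qed
  then obtain m' where m': "m = Suc m'" by (cases m) auto
  \<comment> \<open>Since \<open>c\<close> has order \<open>p ^ Suc m'\<close>, this power has order
    \<open>p\<close>.\<close>
  define z where "z = c [^] (p ^ m')"
  have powZ: "a [^] (k::nat) \<in> ?Z" if "a \<in> ?Z" for a k
    using subgroup_int_pow_closed[OF subgroup_group_center that, of "int k"] by (simp add: int_pow_int)
  have p1: "p > 1" using p by (rule prime_gt_1_nat)
  show ?thesis
  proof (rule that[of z])
    show "z \<in> ?Z" unfolding z_def by (rule powZ[OF c])
    show "z \<noteq> \<one>"
    proof
      assume "z = \<one>"
      then have "p ^ m dvd p ^ m'" using pow_eq_id[OF cG] m by (simp add: z_def)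
      then show False using p1 m' by (simp add: dvd_power_iff_le)
    qed
    show "z [^] p = \<one>"
      using pow_ord_eq_1[OF cG] m m' cG by (simp add: z_def nat_pow_pow mult.commute)
    fix y assume y: "y \<in> ?Z" "y \<noteq> \<one>"
    obtain t :: nat where t: "y = c [^] t" using gen[OF y(1)] by blast
    have t0: "t \<noteq> 0" using t y(2) by (intro notI) simp
    obtain a where a: "gcd t (p ^ m) = p ^ a"
      using divides_primepow_nat[OF p] gcd_dvd2 by blast
    have "a \<le> m'"
    proof (rule ccontr)
      assume "\<not> ?thesis"
      then have "p ^ m dvd p ^ a" using m' by (intro le_imp_power_dvd) simp
      then have "p ^ m dvd t" using a by (metis dvd_trans gcd_dvd1)
      then have "y = \<one>" using t pow_eq_id[OF cG] m by simp
      then show False using y by simp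
    qed
    \<comment> \<open>Bezout makes \<open>c [^] (p ^ a)\<close> a power of \<open>y\<close>; as
      \<open>a \<le> m'\<close>, a further power of it is \<open>z\<close>.\<close>
    obtain u v where uv: "t * u = p ^ m * v + p ^ a"
      using bezout_nat[OF t0, of "p ^ m"] a by auto
    have yG: "y \<in> carrier G" using y by (simp add: group_center_def)
    have "y [^] u = c [^] (p ^ m * v + p ^ a)"
      using t uv cG by (simp add: nat_pow_pow)
    also have "\<dots> = (c [^] (p ^ m)) [^] v \<otimes> c [^] (p ^ a)"
      using cG by (simp add: nat_pow_mult nat_pow_pow)
    also have "\<dots> = c [^] (p ^ a)"
      using pow_ord_eq_1[OF cG] m cG by simp
    finally have "y [^] (u * p ^ (m' - a)) = c [^] (p ^ a * p ^ (m' - a))"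
      using yG cG by (metis nat_pow_pow)
    also have "p ^ a * p ^ (m' - a) = p ^ m'"
      using \<open>a \<le> m'\<close> by (simp flip: power_add)
    finally show "\<exists>k::nat. y [^] k = z" unfolding z_def by blast
  qed
qed

lemma (in group) rep_kernel_normal:
  assumes rep: "group_rep G n \<rho>"
  shows "{g \<in> carrier G. \<rho> g = 1\<^sub>m n} \<lhd> G"
  unfolding normal_inv_iff
proof (intro conjI ballI)
  let ?M = "{g \<in> carrier G. \<rho> g = 1\<^sub>m n}"
  have inv1: "\<rho> (inv g) = 1\<^sub>m n" if "g \<in> ?M" for g
  proof -
    have "\<rho> (inv g) * \<rho> g = \<rho> \<one>"
      using rep_mult[OF rep, of "inv g" g] that by simp
    then show ?thesis
      using that rep_carrier[OF rep, of "inv g"] rep_one[OF rep] by simp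
  qed
  show "subgroup ?M G"
  proof (rule subgroupI)
    show "inv g \<in> ?M" if "g \<in> ?M" for g using inv1[OF that] that by simp
    show "g \<otimes> h \<in> ?M" if "g \<in> ?M" "h \<in> ?M" for g h
      using that rep_mult[OF rep, of g h] by simp
  qed (use rep_one[OF rep] in auto)
  fix x h assume x: "x \<in> carrier G" and h: "h \<in> ?M"
  have "\<rho> (x \<otimes> h \<otimes> inv x) = \<rho> x * \<rho> (inv x)"
    using x h rep_mult[OF rep] rep_carrier[OF rep x] by simp
  also have "\<dots> = 1\<^sub>m n"
    using x rep_mult[OF rep, of x "inv x"] rep_one[OF rep] by simp
  finally show "x \<otimes> h \<otimes> inv x \<in> ?M" using x h by simp
qed

text \<open>A nontrivial kernel, being normal, contains a nontrivial central element, hence also its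
  power \<open>z\<close>, which is excluded. The full trace value at \<open>g\<close> puts
  \<open>g\<close> into the kernel.\<close>

lemma p_group_faithful_rep:
  fixes G (structure)
  assumes p: "prime p" and G: "finite_p_group p G"
    and gen: "\<And>x. x \<in> group_center G \<Longrightarrow> x \<noteq> \<one> \<Longrightarrow> \<exists>k::nat. x [^] k = z"
    and rep: "group_rep G n \<alpha>" and z: "\<alpha> z \<noteq> 1\<^sub>m n"
    and g: "g \<in> carrier G" "trace_mat (\<alpha> g) = of_nat n"
  shows "g = \<one>"
proof (rule ccontr)
  assume "g \<noteq> \<one>"
  interpret group G using G by (simp add: finite_p_group_def)
  have "\<alpha> g = 1\<^sub>m n"
    using finite_rep_trace(2)[OF rep _ g(1)] g(2) G by (simp add: finite_p_group_def)
  then have "{g \<in> carrier G. \<alpha> g = 1\<^sub>m n} \<noteq> {\<one>}"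
    using g(1) \<open>g \<noteq> \<one>\<close> by auto
  then obtain x where x: "x \<in> carrier G" "\<alpha> x = 1\<^sub>m n" "x \<noteq> \<one>" "x \<in> group_center G"
    using p_group_normal_meets_center[OF p G rep_kernel_normal[OF rep]] by auto
  obtain k :: nat where "x [^] k = z" using gen[OF x(4,3)] by blast
  then have "\<alpha> z = 1\<^sub>m n ^\<^sub>m k" using rep_pow[OF rep x(1)] x(2) by metis
  moreover have "1\<^sub>m n ^\<^sub>m k = (1\<^sub>m n :: complex mat)" by (induction k) auto
  ultimately show False using z by simp
qed

text \<open>A representation affording \<open>\<phi>\<close> has degree 1, so \<open>\<phi>\<close>
  is its only matrix entry and inherits multiplicativity.\<close>

lemma linear_characterD:
  fixes G (structure)
  assumes G: "group G" and lin: "linear_character G \<phi>"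
  shows "\<phi> \<one> = 1" "\<And>a b. a \<in> carrier G \<Longrightarrow> b \<in> carrier G \<Longrightarrow> \<phi> (a \<otimes> b) = \<phi> a * \<phi> b"
proof -
  interpret group G by fact
  obtain n \<sigma> where s: "group_rep G n \<sigma>" "affords G \<sigma> \<phi>"
    using lin by (auto simp: linear_character_def is_character_def)
  then have n: "n = 1"
    using char_degree_eq[OF G s] lin by (simp add: linear_character_def)
  have \<phi>: "\<phi> a = \<sigma> a $$ (0, 0)" if "a \<in> carrier G" for a
    using s(2) that trace_mat_sum[OF rep_carrier[OF s(1) that]] n by (simp add: affords_def)
  show "\<phi> \<one> = 1" using \<phi>[of \<one>] rep_one[OF s(1)] n by simp
  show "\<phi> (a \<otimes> b) = \<phi> a * \<phi> b" if ab: "a \<in> carrier G" "b \<in> carrier G" for a b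
    using \<phi>[OF m_closed[OF ab]] \<phi>[OF ab(1)] \<phi>[OF ab(2)] rep_mult[OF s(1) ab]
      rep_carrier[OF s(1) ab(1)] rep_carrier[OF s(1) ab(2)] n
    by (simp add: scalar_prod_def)
qed

text \<open>
  The commutators of \<open>N\<close> lie in the kernel of every conjugate of \<open>\<phi>\<close>, hence in the kernel of the
  faithful induced character; so \<open>N\<close> is abelian.
\<close>

lemma (in group) normally_monomial_degree_le:
  assumes fin: "finite (carrier G)" and nm: "normally_monomial G"
    and irr: "irreducible_rep G n \<alpha>"
    and faithful: "\<And>g. g \<in> carrier G \<Longrightarrow> trace_mat (\<alpha> g) = of_nat n \<Longrightarrow> g = \<one>"
    and \<sigma>: "irreducible_rep G m \<sigma>"
  shows "m \<le> n"
proof -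
  have rep: "group_rep G n \<alpha>" using irr by (simp add: irreducible_rep_def)
  have "irreducible_character G (\<lambda>g. trace_mat (\<alpha> g))"
    using irr by (auto simp: irreducible_character_def affords_def)
  then obtain N \<phi> where N: "N \<lhd> G" and lin: "linear_character (G\<lparr>carrier := N\<rparr>) \<phi>"
    and ind: "\<And>g. g \<in> carrier G \<Longrightarrow> trace_mat (\<alpha> g) = induced_char G N \<phi> g"
    using nm unfolding normally_monomial_def by blast
  have sub: "subgroup N G" and conjN: "\<And>g x. g \<in> carrier G \<Longrightarrow> x \<in> N \<Longrightarrow> g \<otimes> x \<otimes> inv g \<in> N"
    using N by (auto simp: normal_inv_iff)
  have NG: "x \<in> carrier G" if "x \<in> N" for x using that subgroup.subset[OF sub] by blast
  have \<phi>1: "\<phi> \<one> = 1" and \<phi>m: "\<And>a b. a \<in> N \<Longrightarrow> b \<in> N \<Longrightarrow> \<phi> (a \<otimes> b) = \<phi> a * \<phi> b"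
    using linear_characterD[OF subgroup_imp_group[OF sub] lin] by auto
  \<comment> \<open>At the identity every summand of the induced character is
    \<open>\<phi> \<one> = 1\<close>, so the degree is the index of \<open>N\<close>.\<close>
  have deg: "of_nat n = (of_nat (card (carrier G)) / of_nat (card N) :: complex)"
    using ind[of \<one>] trace_rep_one[OF rep] subgroup.one_closed[OF sub] \<phi>1
    by (simp add: induced_char_def)
  have ab: "a \<otimes> b = b \<otimes> a" if a: "a \<in> N" and b: "b \<in> N" for a b
  proof -
    \<comment> \<open>A conjugate of this commutator is the commutator of the conjugates
      \<open>a'\<close> and \<open>b'\<close> in \<open>N\<close>, where \<open>\<phi>\<close> is
      multiplicative and commutative-valued. Hence every summand at \<open>c\<close> is 1, as at the
      identity.\<close>
    define c where "c = a \<otimes> b \<otimes> inv (b \<otimes> a)"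
    have cG: "c \<in> carrier G" using a b NG by (simp add: c_def)
    have "x \<otimes> c \<otimes> inv x \<in> N \<and> \<phi> (x \<otimes> c \<otimes> inv x) = 1" if x: "x \<in> carrier G" for x
    proof -
      define a' b' where "a' = x \<otimes> a \<otimes> inv x" and "b' = x \<otimes> b \<otimes> inv x"
      have a': "a' \<in> N" and b': "b' \<in> N" using conjN x a b by (auto simp: a'_def b'_def)
      have ia: "inv a' \<in> N" and ib: "inv b' \<in> N"
        using subgroup.m_inv_closed[OF sub] a' b' by auto
      have "inv x \<otimes> (x \<otimes> y) = y" if "y \<in> carrier G" for y
        using x that by (simp flip: m_assoc)
      then have "x \<otimes> c \<otimes> inv x = a' \<otimes> b' \<otimes> (inv a' \<otimes> inv b')"
        using a b NG x by (simp add: c_def a'_def b'_def inv_mult_group m_assoc)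
      moreover have "\<phi> a' * \<phi> (inv a') = 1" "\<phi> b' * \<phi> (inv b') = 1"
        using \<phi>m[OF a' ia] \<phi>m[OF b' ib] \<phi>1 NG[OF a'] NG[OF b'] by auto
      moreover have "a' \<otimes> b' \<in> N" "inv a' \<otimes> inv b' \<in> N"
        using subgroup.m_closed[OF sub] a' b' ia ib by auto
      moreover have "\<phi> (a' \<otimes> b' \<otimes> (inv a' \<otimes> inv b')) = (\<phi> a' * \<phi> (inv a')) * (\<phi> b' * \<phi> (inv b'))"
        using \<phi>m a' b' ia ib subgroup.m_closed[OF sub] by simp
      ultimately show ?thesis
        using subgroup.m_closed[OF sub] by simp
    qed
    then have "trace_mat (\<alpha> c) = of_nat n"
      using ind[OF cG] deg by (simp add: induced_char_def)
    then have "c = \<one>" using faithful[OF cG] by simp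
    then show ?thesis using a b NG by (simp add: c_def inv_solve_right')
  qed
  have "card N > 0"
    using subgroup.one_closed[OF sub] finite_subset[OF subgroup.subset[OF sub] fin]
    by (auto simp: card_gt_0_iff)
  then have "of_nat (n * card N) = (of_nat (card (carrier G)) :: complex)"
    using deg by (simp add: field_simps)
  then have "n * card N = card (rcosets N) * card N"
    using lagrange[OF sub] by (simp add: Coset.order_def del: of_nat_mult)
  then have "n = card (rcosets N)" using \<open>card N > 0\<close> by simp
  then show ?thesis using irreducible_degree_le_index[OF \<sigma> fin sub ab] by simp
qed

lemma (in group) cd_iff: "m \<in> cd G \<longleftrightarrow> (\<exists>\<sigma>. irreducible_rep G m \<sigma>)"
proof
  assume "m \<in> cd G"
  then obtain \<chi> n \<sigma> where "irreducible_rep G n \<sigma>" "affords G \<sigma> \<chi>" "m = char_degree G \<chi>"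
    by (auto simp: cd_def irreducible_character_def)
  moreover from this have "char_degree G \<chi> = n"
    using char_degree_eq[OF is_group] by (auto simp: irreducible_rep_def)
  ultimately show "\<exists>\<sigma>. irreducible_rep G m \<sigma>" by auto
next
  assume "\<exists>\<sigma>. irreducible_rep G m \<sigma>"
  then obtain \<sigma> where s: "irreducible_rep G m \<sigma>" by blast
  have a: "affords G \<sigma> (\<lambda>g. trace_mat (\<sigma> g))" by (simp add: affords_def)
  have "char_degree G (\<lambda>g. trace_mat (\<sigma> g)) = m"
    using char_degree_eq[OF is_group _ a] s by (auto simp: irreducible_rep_def)
  moreover have "irreducible_character G (\<lambda>g. trace_mat (\<sigma> g))"
    using s a by (auto simp: irreducible_character_def)
  ultimately show "m \<in> cd G" by (force simp: cd_def)
qed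

text \<open>All that the product argument uses about one factor. The final bound admits reducible
  representations in which \<open>z\<close> acts by a scalar, because an irreducible representation
  of the product need not stay irreducible when restricted to a factor.\<close>

lemma normally_monomial_p_group:
  fixes G (structure)
  assumes p: "prime p" and G: "finite_p_group p G" and nt: "\<not> trivial_group G"
    and nm: "normally_monomial G"
    and cyc: "cyclic_group (G\<lparr>carrier := group_center G\<rparr>)"
  obtains z n \<alpha> where "z \<in> group_center G" "z \<noteq> \<one>" "z [^] p = \<one>" "group_rep G n \<alpha>"
    "\<And>g. g \<in> carrier G \<Longrightarrow> trace_mat (\<alpha> g) = of_nat n \<Longrightarrow> g = \<one>"
    "Max (cd G) = n"
    "\<And>m \<sigma> c. group_rep G m \<sigma> \<Longrightarrow> \<sigma> z = c \<cdot>\<^sub>m 1\<^sub>m m \<Longrightarrow> c \<noteq> 1 \<Longrightarrow> n \<le> m"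
proof -
  interpret group G using G by (simp add: finite_p_group_def)
  have fin: "finite (carrier G)" using G by (simp add: finite_p_group_def)
  obtain z where z: "z \<in> group_center G" "z \<noteq> \<one>" "z [^] p = \<one>"
    and gen: "\<And>x. x \<in> group_center G \<Longrightarrow> x \<noteq> \<one> \<Longrightarrow> \<exists>k::nat. x [^] k = z"
    by (rule p_group_cyclic_center[OF p G nt cyc]; rule that)
  have zG: "z \<in> carrier G" using z by (simp add: group_center_def)
  have faithful: "g = \<one>" if "irreducible_rep G m \<beta>" "\<beta> z \<noteq> 1\<^sub>m m" "g \<in> carrier G"
    "trace_mat (\<beta> g) = of_nat m" for m \<beta> g
    using p_group_faithful_rep[OF p G gen _ that(2-4)] that(1) by (auto simp: irreducible_rep_def)
  \<comment> \<open>Every irreducible representation nontrivial at \<open>z\<close> is faithful, so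
    its degree dominates \<open>cd G\<close>; in particular all such representations share one
    degree.\<close>
  have max: "Max (cd G) = m" if \<beta>: "irreducible_rep G m \<beta>" "\<beta> z \<noteq> 1\<^sub>m m" for m \<beta>
  proof (rule Max_eqI)
    show le: "k \<le> m" if "k \<in> cd G" for k
      using that normally_monomial_degree_le[OF fin nm \<beta>(1) faithful[OF \<beta>]] cd_iff by auto
    show "m \<in> cd G" using \<beta>(1) cd_iff by auto
    show "finite (cd G)" using le by (meson finite_nat_set_iff_bounded_le)
  qed
  obtain r \<rho> where \<rho>: "group_rep G r \<rho>" "\<And>g. g \<in> carrier G \<Longrightarrow> g \<noteq> \<one> \<Longrightarrow> trace_mat (\<rho> g) = 0"
    using exists_regular_rep[OF fin] by blast
  obtain xs where xs: "\<forall>(m, \<sigma>) \<in> set xs. irreducible_rep G m \<sigma>" "r = (\<Sum>(m, \<sigma>)\<leftarrow>xs. m)"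
    "\<forall>g \<in> carrier G. trace_mat (\<rho> g) = (\<Sum>(m, \<sigma>)\<leftarrow>xs. trace_mat (\<sigma> g))"
    using irreducible_decomposition[OF \<rho>(1)] by blast
  \<comment> \<open>If \<open>z\<close> acted trivially on every constituent, its trace in the
    regular representation would be \<open>r > 0\<close> instead of 0.\<close>
  have "\<exists>(m, \<sigma>) \<in> set xs. \<sigma> z \<noteq> 1\<^sub>m m"
  proof (rule ccontr)
    assume "\<not> ?thesis"
    then have "(\<Sum>(m, \<sigma>)\<leftarrow>xs. trace_mat (\<sigma> z)) = (\<Sum>(m, \<sigma>)\<leftarrow>xs. of_nat m)"
      by (intro arg_cong[of _ _ sum_list] map_cong) (auto simp: sum_list_replicate)
    also have "\<dots> = of_nat r" unfolding xs(2) by (induction xs) auto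
    finally show False
      using xs(3) zG \<rho>(2)[OF zG z(2)] rep_pos[OF \<rho>(1)] by simp
  qed
  then obtain n \<alpha> where \<alpha>: "irreducible_rep G n \<alpha>" "\<alpha> z \<noteq> 1\<^sub>m n" using xs(1) by auto
  have rep\<alpha>: "group_rep G n \<alpha>" using \<alpha> by (simp add: irreducible_rep_def)
  have bound: "n \<le> m" if \<sigma>: "group_rep G m \<sigma>" "\<sigma> z = c \<cdot>\<^sub>m 1\<^sub>m m" "c \<noteq> 1" for m \<sigma> c
  proof -
    obtain d \<beta> T where d: "d \<le> m" "irreducible_rep G d \<beta>" and T: "T \<in> carrier_mat m d"
      "\<And>g. g \<in> carrier G \<Longrightarrow> \<sigma> g * T = T * \<beta> g"
      "\<And>v. v \<in> carrier_vec d \<Longrightarrow> T *\<^sub>v v = 0\<^sub>v m \<Longrightarrow> v = 0\<^sub>v d"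
      using exists_irreducible_sub[OF \<sigma>(1)] by blast
    have d0: "d > 0" using d(2) rep_pos by (auto simp: irreducible_rep_def)
    \<comment> \<open>Otherwise the intertwining relation at \<open>z\<close> reads
      \<open>c \<cdot>\<^sub>m T = T\<close> with \<open>c \<noteq> 1\<close>, so
      \<open>T = 0\<close>, against injectivity.\<close>
    have "\<beta> z \<noteq> 1\<^sub>m d"
    proof
      assume "\<beta> z = 1\<^sub>m d"
      then have "c \<cdot>\<^sub>m T = T" using T(2)[OF zG] \<sigma>(2) T(1)
        by (simp add: mult_smult_assoc_mat[of _ m m _ d])
      then have "T $$ (i, j) = 0" if "i < m" "j < d" for i j
        using that T(1) \<sigma>(3) by (metis carrier_matD index_smult_mat(1) mult_cancel_right1)
      then have "T *\<^sub>v unit_vec d 0 = 0\<^sub>v m" using T(1) d0 by (intro eq_vecI) auto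
      then have "unit_vec d 0 = (0\<^sub>v d :: complex vec)" using T(3) by simp
      then have "unit_vec d 0 $ 0 = (0\<^sub>v d :: complex vec) $ 0" by simp
      then show False using d0 by simp
    qed
    \<comment> \<open>Both \<open>d\<close> and \<open>n\<close> equal \<open>Max (cd G)\<close>,
      and \<open>d \<le> m\<close>.\<close>
    then show ?thesis using max[OF d(2)] max[OF \<alpha>] d(1) by simp
  qed
  show ?thesis
    by (rule that[OF z rep\<alpha> faithful[OF \<alpha>] max[OF \<alpha>] bound])
qed

text \<open>As \<open>p\<close> is prime, \<open>a\<close> is a primitive root, so its first
  \<open>p\<close> powers are distinct and exhaust the \<open>p\<close>-th roots of unity, including
  the inverse of \<open>b\<close>.\<close>

lemma root_of_unity_power_inverse:
  fixes a b :: complex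
  assumes p: "prime p" and a: "a ^ p = 1" "a \<noteq> 1" and b: "b ^ p = 1"
  shows "\<exists>k. a ^ k * b = 1"
proof -
  have p0: "p > 0" using p by (simp add: prime_gt_0_nat)
  have neq: "a ^ d \<noteq> 1" if d: "0 < d" "d < p" for d
  proof
    assume ad: "a ^ d = 1"
    have "coprime d p" using p d by (metis coprime_commute nat_dvd_not_less prime_imp_coprime)
    then obtain x y where "d * x = p * y + 1" using bezout_nat[of d p] d by auto
    then have "(a ^ d) ^ x = (a ^ p) ^ y * a" by (simp flip: power_mult add: power_add)
    then show False using ad a by simp
  qed
  have a0: "a \<noteq> 0" using a(1) p0 by (auto simp: power_0_left)
  have "a ^ i \<noteq> a ^ j" if "i < j" "j < p" for i j
  proof
    assume "a ^ i = a ^ j"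
    also have "a ^ j = a ^ i * a ^ (j - i)" using that by (simp flip: power_add)
    finally have "a ^ (j - i) = 1" using a0 by simp
    then show False using neq[of "j - i"] that by simp
  qed
  then have "inj_on (\<lambda>i. a ^ i) {..<p}" by (intro linorder_inj_onI) auto
  moreover have "(\<lambda>i. a ^ i) ` {..<p} \<subseteq> {x. x ^ p = 1}"
    using a by (auto simp flip: power_mult simp: mult.commute[of _ p]) (simp add: power_mult)
  ultimately have "(\<lambda>i. a ^ i) ` {..<p} = {x. x ^ p = 1}"
    using card_roots_unity_eq[OF p0] p0
    by (intro card_subset_eq) (auto simp: card_image intro: card_ge_0_finite)
  moreover have "inverse b \<in> {x. x ^ p = 1}" using b by (simp add: power_inverse)
  ultimately obtain k where "a ^ k = inverse b" by (metis (no_types, lifting) imageE)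
  moreover have "b \<noteq> 0" using b p0 by (auto simp: power_0_left)
  ultimately show ?thesis by (intro exI[of _ k]) simp
qed

section \<open>Minimal faithful characters of the direct product\<close>

theorem theorem1:
  fixes p :: nat
    and H :: "('a, 'm) monoid_scheme"
    and K :: "('b, 'n) monoid_scheme"
    and \<psi> :: "'a \<times> 'b \<Rightarrow> complex"
  assumes "prime p"
    and "finite_p_group p H" and "finite_p_group p K"
    and "\<not> trivial_group H" and "\<not> trivial_group K"
    and "normally_monomial H" and "normally_monomial K"
    and "cyclic_group (H\<lparr>carrier := group_center H\<rparr>)"
    and "cyclic_group (K\<lparr>carrier := group_center K\<rparr>)"
    and "is_arg_min (char_degree (H \<times>\<times> K)) (faithful_character (H \<times>\<times> K)) \<psi>"
  shows "\<exists>\<chi> \<eta>. irreducible_character (H \<times>\<times> K) \<chi> \<and> irreducible_character (H \<times>\<times> K) \<eta> \<and>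
           (\<forall>g \<in> carrier (H \<times>\<times> K). \<psi> g = \<chi> g + \<eta> g) \<and>
           char_degree (H \<times>\<times> K) \<chi> = Max (cd H) \<and>
           char_degree (H \<times>\<times> K) \<eta> = Max (cd K)"
proof -
  let ?G = "H \<times>\<times> K"
  interpret H: group H using assms(2) by (simp add: finite_p_group_def)
  interpret K: group K using assms(3) by (simp add: finite_p_group_def)
  interpret G: group ?G by (rule DirProd_group[OF H.is_group K.is_group])
  have finH: "finite (carrier H)" and finK: "finite (carrier K)"
    using assms(2,3) by (auto simp: finite_p_group_def)

  \<comment> \<open>Central elements and faithful representations of the factors\<close>
  obtain z a \<alpha> where z: "z \<in> group_center H" "z \<noteq> \<one>\<^bsub>H\<^esub>" "z [^]\<^bsub>H\<^esub> p = \<one>\<^bsub>H\<^esub>"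
    and \<alpha>: "group_rep H a \<alpha>" "\<And>g. g \<in> carrier H \<Longrightarrow> trace_mat (\<alpha> g) = of_nat a \<Longrightarrow> g = \<one>\<^bsub>H\<^esub>"
    and a: "Max (cd H) = a"
    and boundH: "\<And>m \<sigma> c. group_rep H m \<sigma> \<Longrightarrow> \<sigma> z = c \<cdot>\<^sub>m 1\<^sub>m m \<Longrightarrow> c \<noteq> 1 \<Longrightarrow> a \<le> m"
    by (rule normally_monomial_p_group[OF assms(1,2,4,6,8)]; rule that)
  obtain w b \<beta> where w: "w \<in> group_center K" "w \<noteq> \<one>\<^bsub>K\<^esub>" "w [^]\<^bsub>K\<^esub> p = \<one>\<^bsub>K\<^esub>"
    and \<beta>: "group_rep K b \<beta>" "\<And>g. g \<in> carrier K \<Longrightarrow> trace_mat (\<beta> g) = of_nat b \<Longrightarrow> g = \<one>\<^bsub>K\<^esub>"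
    and b: "Max (cd K) = b"
    and boundK: "\<And>m \<sigma> c. group_rep K m \<sigma> \<Longrightarrow> \<sigma> w = c \<cdot>\<^sub>m 1\<^sub>m m \<Longrightarrow> c \<noteq> 1 \<Longrightarrow> b \<le> m"
    by (rule normally_monomial_p_group[OF assms(1,3,5,7,9)]; rule that)
  have zH: "z \<in> carrier H" and wK: "w \<in> carrier K" using z w by (auto simp: group_center_def)

  \<comment> \<open>A faithful character of degree \<open>a + b\<close>\<close>
  have \<alpha>': "group_rep ?G a (\<lambda>g. \<alpha> (fst g))"
    using \<alpha>(1) by (auto simp: G.group_rep_iff H.group_rep_iff)
  have \<beta>': "group_rep ?G b (\<lambda>g. \<beta> (snd g))"
    using \<beta>(1) by (auto simp: G.group_rep_iff K.group_rep_iff)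
  define \<tau> where "\<tau> g = four_block_mat (\<alpha> (fst g)) (0\<^sub>m a b) (0\<^sub>m b a) (\<beta> (snd g))" for g
  have \<tau>: "group_rep ?G (a + b) \<tau>"
    unfolding \<tau>_def by (rule G.group_rep_direct_sum[OF \<alpha>' \<beta>'])
  have tr\<tau>: "trace_mat (\<tau> g) = trace_mat (\<alpha> (fst g)) + trace_mat (\<beta> (snd g))"
    if "g \<in> carrier ?G" for g
    unfolding \<tau>_def
    using trace_mat_four_block[OF G.rep_carrier[OF \<alpha>' that] G.rep_carrier[OF \<beta>' that]] .
  have aff\<tau>: "affords ?G \<tau> (\<lambda>g. trace_mat (\<tau> g))" by (simp add: affords_def)
  have "faithful_character ?G (\<lambda>g. trace_mat (\<tau> g))"
    unfolding faithful_character_def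
  proof
    show "is_character ?G (\<lambda>g. trace_mat (\<tau> g))"
      using \<tau> aff\<tau> by (auto simp: is_character_def)
    have "g = \<one>\<^bsub>?G\<^esub>" if g: "g \<in> carrier ?G" "trace_mat (\<tau> g) = of_nat (a + b)" for g
    proof -
      have h: "fst g \<in> carrier H" and k: "snd g \<in> carrier K" using g(1) by auto
      have sum: "trace_mat (\<alpha> (fst g)) + trace_mat (\<beta> (snd g)) = of_nat a + of_nat b"
        using g tr\<tau> by simp
      have fing: "finite (carrier ?G)" using finH finK by simp
      \<comment> \<open>Two bounded real parts whose sum reaches \<open>a + b\<close> both reach
        their bounds, so each coordinate of \<open>g\<close> lies in the kernel of its factor's
        faithful representation.\<close>
      have le: "Re (trace_mat (\<alpha> (fst g))) \<le> a" "Re (trace_mat (\<beta> (snd g))) \<le> b"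
        using G.finite_rep_trace(1)[OF \<alpha>' fing g(1)] G.finite_rep_trace(1)[OF \<beta>' fing g(1)] by auto
      have re: "Re (trace_mat (\<alpha> (fst g))) = a" "Re (trace_mat (\<beta> (snd g))) = b"
        using le arg_cong[OF sum, of Re] by auto
      have "trace_mat (\<alpha> (fst g)) = of_nat a" "trace_mat (\<beta> (snd g)) = of_nat b"
        using G.finite_rep_trace(2)[OF \<alpha>' fing g(1)] G.finite_rep_trace(2)[OF \<beta>' fing g(1)] re
        by (auto simp: sum_list_replicate)
      then show ?thesis using \<alpha>(2)[OF h] \<beta>(2)[OF k] by (simp add: prod_eq_iff)
    qed
    then show "char_kernel ?G (\<lambda>g. trace_mat (\<tau> g)) = {\<one>\<^bsub>?G\<^esub>}"
      using G.trace_rep_one[OF \<tau>] by (auto simp: char_kernel_def)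
  qed
  then have "char_degree ?G \<psi> \<le> char_degree ?G (\<lambda>g. trace_mat (\<tau> g))"
    using assms(10) by (auto simp: is_arg_min_def not_less)
  then have upper: "char_degree ?G \<psi> \<le> a + b"
    using char_degree_eq[OF G.is_group \<tau> aff\<tau>] by simp

  \<comment> \<open>Irreducible constituents of the minimal character\<close>
  have faithful: "faithful_character ?G \<psi>" using assms(10) by (simp add: is_arg_min_def)
  then obtain n \<rho> where \<rho>: "group_rep ?G n \<rho>" "affords ?G \<rho> \<psi>"
    by (auto simp: faithful_character_def is_character_def)
  have n: "n \<le> a + b" using upper char_degree_eq[OF G.is_group \<rho>] by simp
  have ker: "g = \<one>\<^bsub>?G\<^esub>" if "g \<in> carrier ?G" "trace_mat (\<rho> g) = of_nat n" for g
    using faithful that \<rho>(2) G.trace_rep_one[OF \<rho>(1)]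
    by (auto simp: faithful_character_def char_kernel_def affords_def)
  obtain xs where xs: "\<forall>(m, \<sigma>) \<in> set xs. irreducible_rep ?G m \<sigma>" "n = (\<Sum>(m, \<sigma>)\<leftarrow>xs. m)"
    "\<forall>g \<in> carrier ?G. trace_mat (\<rho> g) = (\<Sum>(m, \<sigma>)\<leftarrow>xs. trace_mat (\<sigma> g))"
    using G.irreducible_decomposition[OF \<rho>(1)] by blast
  \<comment> \<open>Constituents are addressed by position, so that repeated ones count
    separately.\<close>
  define I where "I = {..<length xs}"
  define m where "m i = fst (xs ! i)" for i
  define \<sigma> where "\<sigma> i = snd (xs ! i)" for i
  have irr: "irreducible_rep ?G (m i) (\<sigma> i)" if "i \<in> I" for i
    using xs(1) that nth_mem[of i xs] by (auto simp: I_def m_def \<sigma>_def case_prod_beta)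
  have rep: "group_rep ?G (m i) (\<sigma> i)" if "i \<in> I" for i
    using irr[OF that] by (simp add: irreducible_rep_def)
  have n_sum: "n = (\<Sum>i\<in>I. m i)"
    unfolding xs(2) by (simp add: sum_list_sum_nth I_def m_def case_prod_beta atLeast0LessThan)
  have tr_sum: "trace_mat (\<rho> g) = (\<Sum>i\<in>I. trace_mat (\<sigma> i g))" if "g \<in> carrier ?G" for g
    unfolding bspec[OF xs(3) that]
    by (subst sum_list_sum_nth) (simp add: I_def \<sigma>_def case_prod_beta atLeast0LessThan)
  have nontriv: "\<exists>i\<in>I. \<sigma> i g \<noteq> 1\<^sub>m (m i)" if g: "g \<in> carrier ?G" "g \<noteq> \<one>\<^bsub>?G\<^esub>" for g
  proof (rule ccontr)
    assume "\<not> ?thesis"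
    then have "trace_mat (\<rho> g) = of_nat n"
      unfolding tr_sum[OF g(1)] n_sum of_nat_sum
      by (intro sum.cong) (auto simp: sum_list_replicate)
    then show False using ker[OF g(1)] g(2) by simp
  qed

  \<comment> \<open>Scalars by which the central elements act\<close>
  let ?z = "(z, \<one>\<^bsub>K\<^esub>)" and ?w = "(\<one>\<^bsub>H\<^esub>, w)"
  have zG: "?z \<in> carrier ?G" and wG: "?w \<in> carrier ?G" using zH wK by auto
  have "?z \<in> group_center ?G" "?w \<in> group_center ?G"
    using z w by (auto simp: group_center_def)
  then have "\<exists>c. \<sigma> i ?z = c \<cdot>\<^sub>m 1\<^sub>m (m i)" "\<exists>c. \<sigma> i ?w = c \<cdot>\<^sub>m 1\<^sub>m (m i)" if "i \<in> I" for i
    using G.irreducible_center_scalar[OF irr[OF that]] by metis+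
  then obtain c e where c: "\<And>i. i \<in> I \<Longrightarrow> \<sigma> i ?z = c i \<cdot>\<^sub>m 1\<^sub>m (m i)"
    and e: "\<And>i. i \<in> I \<Longrightarrow> \<sigma> i ?w = e i \<cdot>\<^sub>m 1\<^sub>m (m i)"
    by metis
  have m0: "m i > 0" if "i \<in> I" for i using G.rep_pos[OF rep[OF that]] .
  have powz: "?z [^]\<^bsub>?G\<^esub> k = (z [^]\<^bsub>H\<^esub> k, \<one>\<^bsub>K\<^esub>)" for k :: nat
    using zH by (induction k) auto
  have poww: "?w [^]\<^bsub>?G\<^esub> k = (\<one>\<^bsub>H\<^esub>, w [^]\<^bsub>K\<^esub> k)" for k :: nat
    using wK by (induction k) auto
  have scalar_pow: "(x \<cdot>\<^sub>m 1\<^sub>m l) ^\<^sub>m k = x ^ k \<cdot>\<^sub>m (1\<^sub>m l :: complex mat)" for x l k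
    by (induction k) (auto simp: mult_smult_assoc_mat[of _ l l _ l] mult_smult_distrib[of _ l l _ l] mult.commute)
  have scalar_one: "x \<cdot>\<^sub>m 1\<^sub>m l = (1\<^sub>m l :: complex mat) \<longleftrightarrow> x = 1" if "l > 0" for x l
  proof
    assume "x \<cdot>\<^sub>m 1\<^sub>m l = (1\<^sub>m l :: complex mat)"
    then have "(x \<cdot>\<^sub>m 1\<^sub>m l) $$ (0, 0) = (1\<^sub>m l :: complex mat) $$ (0, 0)" by simp
    then show "x = 1" using that by simp
  qed auto
  have ce_pow: "c i ^ p = 1" "e i ^ p = 1" if i: "i \<in> I" for i
  proof -
    have "c i ^ p \<cdot>\<^sub>m 1\<^sub>m (m i) = \<sigma> i (?z [^]\<^bsub>?G\<^esub> p)"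
      unfolding G.rep_pow[OF rep[OF i] zG] c[OF i] scalar_pow ..
    also have "\<dots> = 1\<^sub>m (m i)"
      unfolding powz z(3) using G.rep_one[OF rep[OF i]] by simp
    finally show "c i ^ p = 1" using scalar_one[OF m0[OF i]] by blast
    have "e i ^ p \<cdot>\<^sub>m 1\<^sub>m (m i) = \<sigma> i (?w [^]\<^bsub>?G\<^esub> p)"
      unfolding G.rep_pow[OF rep[OF i] wG] e[OF i] scalar_pow ..
    also have "\<dots> = 1\<^sub>m (m i)"
      unfolding poww w(3) using G.rep_one[OF rep[OF i]] by simp
    finally show "e i ^ p = 1" using scalar_one[OF m0[OF i]] by blast
  qed
  obtain i0 where i0: "i0 \<in> I" "c i0 \<noteq> 1"
    using nontriv[OF zG] z(2) by (auto simp: c scalar_one[OF m0])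
  obtain j0 where j0: "j0 \<in> I" "e j0 \<noteq> 1"
    using nontriv[OF wG] w(2) by (auto simp: e scalar_one[OF m0])

  \<comment> \<open>Two distinct constituents, one for each factor\<close>
  have "\<exists>i\<in>I. \<exists>j\<in>I. i \<noteq> j \<and> c i \<noteq> 1 \<and> e j \<noteq> 1"
  proof (rule ccontr)
    assume "\<not> ?thesis"
    \<comment> \<open>Failure forces \<open>i0 = j0\<close>; any other index with a nontrivial
      scalar would form an admissible pair with it.\<close>
    then have only: "c i = 1 \<and> e i = 1" if "i \<in> I" "i \<noteq> i0" for i
      using i0 j0 that by metis
    have e0: "e i0 ^ p = 1" "c i0 ^ p = 1" using ce_pow i0 by auto
    obtain k where k: "c i0 ^ k * e i0 = 1"
      using root_of_unity_power_inverse[OF assms(1) e0(2) i0(2) e0(1)] by blast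
    \<comment> \<open>\<open>k\<close> is chosen so that this element acts trivially at
      \<open>i0\<close>; elsewhere both scalars are 1. Its second coordinate is \<open>w\<close>, so
      it is a nontrivial element of the kernel.\<close>
    define g where "g = ?z [^]\<^bsub>?G\<^esub> k \<otimes>\<^bsub>?G\<^esub> ?w"
    have g: "g \<in> carrier ?G" unfolding g_def using zG wG by (intro G.m_closed G.nat_pow_closed)
    have "g = (z [^]\<^bsub>H\<^esub> k, w)" using zH wK by (simp add: g_def powz)
    then have "g \<noteq> \<one>\<^bsub>?G\<^esub>" using w(2) by simp
    moreover have "\<sigma> i g = 1\<^sub>m (m i)" if i: "i \<in> I" for i
    proof -
      have "\<sigma> i g = (c i ^ k \<cdot>\<^sub>m 1\<^sub>m (m i)) * (e i \<cdot>\<^sub>m 1\<^sub>m (m i))"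
        unfolding g_def using G.rep_mult[OF rep[OF i] G.nat_pow_closed[OF zG] wG, of k]
          G.rep_pow[OF rep[OF i] zG, of k] c[OF i] e[OF i] scalar_pow by simp
      also have "\<dots> = (c i ^ k * e i) \<cdot>\<^sub>m 1\<^sub>m (m i)"
        by (intro eq_matI) (auto simp: mult_smult_assoc_mat[of _ "m i" "m i" _ "m i"])
      also have "c i ^ k * e i = 1" using k only[OF i] by (cases "i = i0") auto
      finally show ?thesis using scalar_one[OF m0[OF i], of 1] by simp
    qed
    ultimately show False using nontriv[OF g] by auto
  qed
  then obtain i j where ij: "i \<in> I" "j \<in> I" "i \<noteq> j" "c i \<noteq> 1" "e j \<noteq> 1" by blast

  \<comment> \<open>Restriction to the factors and comparison of degrees\<close>
  have repH: "group_rep H (m i) (\<lambda>h. \<sigma> i (h, \<one>\<^bsub>K\<^esub>))"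
    unfolding H.group_rep_iff
  proof (intro conjI ballI)
    fix g h assume "g \<in> carrier H" "h \<in> carrier H"
    then show "\<sigma> i (g \<otimes>\<^bsub>H\<^esub> h, \<one>\<^bsub>K\<^esub>) = \<sigma> i (g, \<one>\<^bsub>K\<^esub>) * \<sigma> i (h, \<one>\<^bsub>K\<^esub>)"
      using G.rep_mult[OF rep[OF ij(1)], of "(g, \<one>\<^bsub>K\<^esub>)" "(h, \<one>\<^bsub>K\<^esub>)"] by simp
  qed (use m0[OF ij(1)] G.rep_one[OF rep[OF ij(1)]] G.rep_carrier[OF rep[OF ij(1)]] in auto)
  have repK: "group_rep K (m j) (\<lambda>k. \<sigma> j (\<one>\<^bsub>H\<^esub>, k))"
    unfolding K.group_rep_iff
  proof (intro conjI ballI)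
    fix g h assume "g \<in> carrier K" "h \<in> carrier K"
    then show "\<sigma> j (\<one>\<^bsub>H\<^esub>, g \<otimes>\<^bsub>K\<^esub> h) = \<sigma> j (\<one>\<^bsub>H\<^esub>, g) * \<sigma> j (\<one>\<^bsub>H\<^esub>, h)"
      using G.rep_mult[OF rep[OF ij(2)], of "(\<one>\<^bsub>H\<^esub>, g)" "(\<one>\<^bsub>H\<^esub>, h)"] by simp
  qed (use m0[OF ij(2)] G.rep_one[OF rep[OF ij(2)]] G.rep_carrier[OF rep[OF ij(2)]] in auto)
  have lower: "a \<le> m i" "b \<le> m j"
    using boundH[OF repH c[OF ij(1)] ij(4)] boundK[OF repK e[OF ij(2)] ij(5)] by auto
  have finI: "finite I" by (simp add: I_def)
  have "(\<Sum>l\<in>I. m l) = (\<Sum>l\<in>{i, j}. m l) + (\<Sum>l\<in>I - {i, j}. m l)"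
    using sum.subset_diff[of "{i, j}" I m] finI ij by (simp add: add.commute)
  then have *: "n = m i + m j + (\<Sum>l\<in>I - {i, j}. m l)"
    using n_sum ij(3) by simp
  \<comment> \<open>The upper bound \<open>n \<le> a + b\<close> from minimality meets the lower
    bounds for \<open>m i\<close> and \<open>m j\<close>; since degrees are positive, no further
    index remains.\<close>
  then have "(\<Sum>l\<in>I - {i, j}. m l) = 0" and mi: "m i = a" and mj: "m j = b"
    using lower n by linarith+
  then have I: "I = {i, j}"
    using m0 finI ij by (force simp: sum_eq_0_iff)
  show ?thesis
  proof (intro exI conjI ballI)
    show "irreducible_character ?G (\<lambda>g. trace_mat (\<sigma> i g))"
      "irreducible_character ?G (\<lambda>g. trace_mat (\<sigma> j g))"
      using irr ij by (auto simp: irreducible_character_def affords_def)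
    show "\<psi> g = trace_mat (\<sigma> i g) + trace_mat (\<sigma> j g)" if "g \<in> carrier ?G" for g
      using bspec[OF \<rho>(2)[unfolded affords_def] that] tr_sum[OF that] ij(3) by (simp add: I)
    show "char_degree ?G (\<lambda>g. trace_mat (\<sigma> i g)) = Max (cd H)"
      using char_degree_eq[OF G.is_group rep[OF ij(1)]] mi a by (simp add: affords_def)
    show "char_degree ?G (\<lambda>g. trace_mat (\<sigma> j g)) = Max (cd K)"
      using char_degree_eq[OF G.is_group rep[OF ij(2)]] mj b by (simp add: affords_def)
  qed
qed

end
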